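(* For $\eta\in\Omega$ we have $f(\eta)=g(\eta)(1+O(|\eta|^{-1}))$; that is, there is a constant $K$ such that $|f(\eta)/g(\eta)-1|\le K/|\eta|$ for all $\eta\in\Omega$.
   Context: $\mathcal R(s)$ is Riemann's auxiliary function, the entire function defined by $$\mathcal R(s)=\int_{0\swarrow 1}\frac{x^{-s}e^{\pi i x^2}}{e^{\pi i x}-e^{-\pi i x}}\,dx ,$$ where the path is the straight line of direction $e^{i\pi/4}$ crossing the real axis at a point strictly between $0$ and $1$, traversed from upper right to lower left, and $x^{-s}=\exp(-s\log x)$ with the principal logarithm. $\zeta$ is the Riemann zeta function and $\chi(s)=2^s\pi^{s-1}\sin\frac{\pi s}{2}\,\Gamma(1-s)$, so that $\zeta(s)=\chi(s)\zeta(1-s)$. $$\Omega=\Bigl\{re^{i\phi}\colon e<r,\ \frac{\pi}{4}<\phi<\frac{\pi}{2}-\frac{\log r}{r^2}\Bigr\},$$ $$f(\eta)=\frac{\chi(-2\pi i\eta^2)\,\mathcal R(1+2\pi i\eta^2)}{\zeta(-2\pi i\eta^2)},\qquad g(\eta)=e^{\pi i u(\eta)},\qquad u(\eta)=2\eta^2\log\eta-\eta^2+\eta+i\frac{\log 2}{2\pi}-\frac18,$$ where $\log\eta$ is the branch with $0<\Im\log\eta<\pi$ for $\Im\eta>0$. *)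

theory Defs
  imports "HOL-Complex_Analysis.Complex_Analysis"
begin

(* For Re s > 1 this is the Dirichlet series; elsewhere it is a holomorphic continuation of the
   series to the plane punctured at 1. Any two such continuations agree off 1, so the choice
   only affects the value at 1, which is never used. *)
definition zeta :: "complex \<Rightarrow> complex" where
  "zeta s =
     (if Re s > 1 then \<Sum>n. of_nat (Suc n) powr (- s)
      else (SOME h. h holomorphic_on (- {1}) \<and>
              (\<forall>w. Re w > 1 \<longrightarrow> h w = (\<Sum>n. of_nat (Suc n) powr (- w)))) s)"

(* Gamma is 0 at its poles here, so at positive integers this is not the meromorphic function
   (which has poles at the odd ones and nonzero values at the even ones). On Omega the argument
   of chi is never real. *)
definition chi :: "complex \<Rightarrow> complex" where
  "chi s = 2 powr s * of_real pi powr (s - 1) * sin (of_real pi * s / 2) * Gamma (1 - s)"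

(* The contour is x = c + t * cis (pi/4) with t running from +infinity down to -infinity, hence
   the minus sign. By Cauchy's theorem the value is the same for all c with 0 < c < 1. The contour
   avoids the branch cut of the principal logarithm underlying powr. *)
definition Riemann_aux :: "real \<Rightarrow> complex \<Rightarrow> complex" where
  "Riemann_aux c s =
     - (LINT t|lborel.
          (let x = of_real c + of_real t * cis (pi / 4)
           in x powr (- s) * exp (of_real pi * \<i> * x\<^sup>2)
                / (exp (of_real pi * \<i> * x) - exp (- (of_real pi * \<i> * x))) * cis (pi / 4)))"

definition Omega :: "complex set" where
  "Omega = {of_real r * cis \<phi> | r \<phi>.
      exp 1 < r \<and> pi / 4 < \<phi> \<and> \<phi> < pi / 2 - ln r / r\<^sup>2}"

(* The parameter c is the crossing point of the contour in Riemann_aux. *)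
definition f_Omega :: "real \<Rightarrow> complex \<Rightarrow> complex" where
  "f_Omega c \<eta> =
     chi (- (2 * of_real pi * \<i> * \<eta>\<^sup>2)) * Riemann_aux c (1 + 2 * of_real pi * \<i> * \<eta>\<^sup>2)
       / zeta (- (2 * of_real pi * \<i> * \<eta>\<^sup>2))"

(* For Im \<eta> > 0, the principal branch satisfies 0 < Im (Ln \<eta>) < pi. *)
definition u_Omega :: "complex \<Rightarrow> complex" where
  "u_Omega \<eta> = 2 * \<eta>\<^sup>2 * Ln \<eta> - \<eta>\<^sup>2 + \<eta> + \<i> * of_real (ln 2 / (2 * pi)) - 1 / 8"

definition g_Omega :: "complex \<Rightarrow> complex" where
  "g_Omega \<eta> = exp (of_real pi * \<i> * u_Omega \<eta>)"

end

theory Submission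
  imports Defs "HOL-Real_Asymp.Real_Asymp" "HOL-Probability.Characteristic_Functions" "HOL-Probability.Sinc_Integral"
begin

text \<open>Put \<open>\<eta> = e^(\<pi>i/4) \<omega>\<close> and \<open>w = -2\<pi>i \<eta>^2 = 2\<pi> \<omega>^2\<close>. For \<open>Re w > 2\<close> the two halves of the
  contour of \<open>R(1-w)\<close>, the lower one reflected in the origin, are both deformed into a path from
  \<open>0\<close> to infinity, which gives \<open>R(1-w) = e^(\<pi>iw/4) (1 + e^(-\<pi>iw)) J(w)\<close> with
  \<open>J(w) = \<integral> z^(w-1) e^(-\<pi> z^2) k(z) dz\<close> over the positive real axis. The factor \<open>1 + e^(-\<pi>iw)\<close>
  cancels against the cosine in \<open>\<chi>(w) = (2\<pi>)^w / (2 cos(\<pi>w/2) \<Gamma>(w))\<close>.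
  The saddle point of \<open>z^w e^(-\<pi> z^2)\<close> is \<open>\<omega>\<close>, and the path \<open>0 \<rightarrow> \<omega> - |\<omega>|/2 \<rightarrow> \<omega> + \<infinity>\<close> works uniformly
  for \<open>0 < arg \<omega> < \<pi>/4\<close>: the integrand increases along the first segment and is dominated by
  \<open>e^(-\<pi> s^2)\<close> at \<open>\<omega> + s\<close>. With \<open>k = 1\<close> the same estimate is Stirling's formula for \<open>\<Gamma>(w)\<close>.
  Finally \<open>Re w \<ge> 6 log |\<eta>|\<close> on \<open>\<Omega>\<close>, so that \<open>\<zeta>(w) = 1 + O(1/|\<eta>|)\<close>.\<close>

section \<open>Half-line integrals in a rotated half plane\<close>

text \<open>The obstacle is uniformity at the edges of \<Omega>. When arg \<omega> is close to
  \<pi>/4, Re w may be as small as a multiple of log |\<eta>|, so the constants may depend neither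
  on arg \<omega> nor on Re w. The kernel of J has poles on the line Re z + Im z = 0, but Re
  \<omega> + Im \<omega> is at least |\<omega>|, so on the horizontal ray Re z + Im z is at least
  |\<omega>|/2, and there the kernel is e^(bz) (1 + O(1/|\<omega>|)) with b = \<pi> i e^(\<pi>i/4).
  This explains the last terms of u. The term \<eta> is the factor e^(b\<omega>). The Gaussian
  integral of e^(-2\<pi> s^2 + bs) is e^(b^2/(8\<pi>)) / sqrt 2 = e^(-\<pi>i/8) / sqrt 2, which
  gives -1/8 and i log 2/(2\<pi>). Hence f/g is exactly a product of three quotients, one each for
  Gamma, J and zeta, and each of them is 1 + O(1/|\<eta>|). Contours are deformed through a
  primitive on a convex set, so that comparing two paths means comparing values of one
  function.\<close>

lemma norm_powr_complex_le:
  "cmod (z powr s) \<le> cmod z powr Re s * exp (pi * \<bar>Im s\<bar>)"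
proof -
  have "\<bar>Im s * Arg z\<bar> \<le> pi * \<bar>Im s\<bar>"
    using mpi_less_Arg[of z] Arg_le_pi[of z]
    by (simp add: abs_mult abs_le_iff mult.commute[of pi] mult_left_mono)
  then have "- Im s * Arg z \<le> pi * \<bar>Im s\<bar>" by linarith
  then show ?thesis
    by (simp add: norm_powr_complex mult_left_mono)
qed

text \<open>\<open>Sec\<close> is the open upper half plane together with the segment \<open>(-1, 1)\<close>, rotated by \<open>-\<pi>/4\<close>.
  It contains the starting points of both half contours and avoids the other zeros of \<open>sin(\<pi>x)\<close>.\<close>

definition Sec :: "complex set" where
  "Sec = {z. Re z + Im z > 0} \<union> {z. Re z + Im z = 0 \<and> cmod z < 1}"

lemma zero_in_Sec [simp]: "0 \<in> Sec"
  by (simp add: Sec_def)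

lemma Sec_nonneg: "z \<in> Sec \<Longrightarrow> 0 \<le> Re z + Im z"
  by (auto simp: Sec_def)

lemma Sec_not_nonpos:
  assumes "z \<in> Sec" "z \<noteq> 0"
  shows "z \<notin> \<real>\<^sub>\<le>\<^sub>0"
  using assms by (auto simp: Sec_def complex_nonpos_Reals_iff complex_eq_iff)

lemma Sec_add: "a \<in> Sec \<Longrightarrow> 0 < t \<Longrightarrow> Re (a + of_real t) + Im (a + of_real t) > 0"
  by (auto simp: Sec_def)

lemma open_half_plane: "open {z. Re z + Im z > 0}"
  by (intro open_Collect_less continuous_intros)

lemma half_plane_subset_Sec: "{z. Re z + Im z > 0} \<subseteq> Sec"
  by (auto simp: Sec_def)

lemma interior_Sec: "interior Sec = {z. Re z + Im z > 0}"
proof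
  show "{z. Re z + Im z > 0} \<subseteq> interior Sec"
    by (intro interior_maximal half_plane_subset_Sec open_half_plane)
  have "Sec \<subseteq> {z. Re z + Im z \<ge> 0}"
    using Sec_nonneg by auto
  then have "interior Sec \<subseteq> interior {z. inner (Complex 1 1) z \<ge> 0}"
    by (intro interior_mono) (auto simp: inner_complex_def)
  also have "\<dots> = {z. inner (Complex 1 1) z > 0}"
    by (intro interior_halfspace_ge) (auto simp: complex_eq_iff)
  finally show "interior Sec \<subseteq> {z. Re z + Im z > 0}"
    by (auto simp: inner_complex_def)
qed

text \<open>A convex combination of points of \<open>Sec\<close> meets the boundary line only if it
  is an endpoint or if both endpoints lie on that line; in the second case the convexity of the unit
  ball decides. Convexity is what provides a primitive on \<open>Sec\<close>.\<close>

lemma convex_Sec: "convex Sec"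
  unfolding convex_alt
proof (intro ballI allI impI)
  fix x y :: complex and u :: real
  assume xy: "x \<in> Sec" "y \<in> Sec" and u: "0 \<le> u \<and> u \<le> 1"
  let ?z = "(1 - u) *\<^sub>R x + u *\<^sub>R y"
  have V: "Re ?z + Im ?z = (1 - u) * (Re x + Im x) + u * (Re y + Im y)"
    by (simp add: algebra_simps)
  show "?z \<in> Sec"
  proof (cases "Re ?z + Im ?z > 0")
    case False
    have n: "(1 - u) * (Re x + Im x) \<ge> 0" "u * (Re y + Im y) \<ge> 0"
      using u xy Sec_nonneg by auto
    with False V have e: "(1 - u) * (Re x + Im x) = 0" "u * (Re y + Im y) = 0"
      by linarith+
    consider "u = 0" | "u = 1" | "Re x + Im x = 0" "Re y + Im y = 0"
      using e by auto
    then show ?thesis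
    proof cases
      case 3
      then have b: "x \<in> ball 0 1" "y \<in> ball 0 1"
        using xy by (auto simp: Sec_def)
      have "?z \<in> ball 0 1"
        using convex_ball[of "0::complex" 1] b u unfolding convex_alt by blast
      then show ?thesis
        using V 3 by (auto simp: Sec_def)
    qed (use xy in auto)
  qed (simp add: Sec_def)
qed

text \<open>\<open>K z / z\<close> is the kernel \<open>k\<close> of the integral; it may have a simple pole at \<open>0\<close>, and it behaves like
  \<open>e^(bz)\<close> away from the boundary of the half plane.\<close>

locale saddle_kernel =
  fixes K :: "complex \<Rightarrow> complex" and b :: complex and B :: real
  assumes cont: "continuous_on Sec K"
    and hol: "K holomorphic_on {z. Re z + Im z > 0}"
    and b_le: "Re z + Im z \<ge> 0 \<Longrightarrow> Re (b * z) \<le> 0"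
    and B_nonneg: "B \<ge> 0"
    and asymp: "Re z + Im z > 0 \<Longrightarrow> cmod (K z / z * exp (- (b * z)) - 1) \<le> B / (Re z + Im z)"
begin

text \<open>The integrand z^(w-1) e^(-\<pi> z^2) k(z), with one power of z moved into
  \<open>K\<close> so that a simple pole of the kernel at 0 does no harm.\<close>

definition G :: "complex \<Rightarrow> complex \<Rightarrow> complex" where
  "G w z = z powr (w - 2) * K z * exp (- of_real pi * z\<^sup>2)"

definition J :: "complex \<Rightarrow> complex" where
  "J w = (LBINT t:{0..}. G w (of_real t))"

lemma G_0 [simp]: "G w 0 = 0"
  by (simp add: G_def)

lemma norm_K_le:
  assumes "Re z + Im z > 0"
  shows "cmod (K z) \<le> cmod z * (1 + B / (Re z + Im z))"
proof -
  have z: "z \<noteq> 0" using assms by auto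
  have "cmod (K z / z * exp (- (b * z))) \<le> 1 + B / (Re z + Im z)"
    using asymp[OF assms] norm_triangle_ineq2[of "K z / z * exp (- (b * z))" 1] by simp
  moreover have "cmod (K z) = cmod z * cmod (K z / z * exp (- (b * z))) * exp (Re (b * z))"
    using z by (simp add: norm_mult norm_divide norm_exp_eq_Re exp_minus field_simps exp_diff exp_add)
  moreover have "exp (Re (b * z)) \<le> 1"
    using b_le[of z] assms by simp
  ultimately show ?thesis
    by (smt (verit, best) mult_left_le mult_left_mono norm_ge_zero mult_nonneg_nonneg)
qed

text \<open>At 0 the kernel factor \<open>K\<close> has a finite limit and |z|^(Re w - 2) tends to
  0, in agreement with the value 0 of \<open>powr\<close> there. This is the source of the condition
  Re w > 2.\<close>

lemma continuous_on_G:
  assumes "Re w > 2"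
  shows "continuous_on Sec (G w)"
  unfolding continuous_on_eq_continuous_within
proof
  fix z assume z: "z \<in> Sec"
  have K: "continuous (at z within Sec) K"
    using cont z by (simp add: continuous_on_eq_continuous_within)
  show "continuous (at z within Sec) (G w)"
  proof (cases "z = 0")
    case False
    then have "isCont (\<lambda>z. z powr (w - 2)) z" "isCont (\<lambda>z. exp (- of_real pi * z\<^sup>2)) z"
      using Sec_not_nonpos[OF z] by (auto intro!: continuous_intros)
    then show ?thesis
      unfolding G_def by (intro continuous_mult K) (auto intro: continuous_at_imp_continuous_at_within)
  next
    case True
    have "((\<lambda>z. z powr (w - 2)) \<longlongrightarrow> 0) (at 0 within Sec)"
    proof (rule Lim_null_comparison)
      show "\<forall>\<^sub>F z in at 0 within Sec. cmod (z powr (w - 2)) \<le> cmod z powr (Re w - 2) * exp (pi * \<bar>Im w\<bar>)"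
      using norm_powr_complex_le[of _ "w - 2"] by simp
      have "((\<lambda>x. cmod x powr (Re w - 2) * exp (pi * \<bar>Im w\<bar>)) \<longlongrightarrow> cmod 0 powr (Re w - 2) * exp (pi * \<bar>Im w\<bar>)) (at 0 within Sec)"
        using assms by (intro tendsto_intros) (auto intro: always_eventually)
      then show "((\<lambda>x. cmod x powr (Re w - 2) * exp (pi * \<bar>Im w\<bar>)) \<longlongrightarrow> 0) (at 0 within Sec)"
        by simp
    qed
    moreover have "(K \<longlongrightarrow> K 0) (at 0 within Sec)"
      using K True by (simp add: continuous_within)
    ultimately have "((\<lambda>z. z powr (w - 2) * K z * exp (- of_real pi * z\<^sup>2)) \<longlongrightarrow> 0 * K 0 * exp (- of_real pi * 0\<^sup>2)) (at 0 within Sec)"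
      by (intro tendsto_intros)
    then show ?thesis
      using True unfolding continuous_within by (simp add: G_def[abs_def])
  qed
qed

lemma holomorphic_on_G: "G w holomorphic_on {z. Re z + Im z > 0}"
  unfolding G_def
  by (intro holomorphic_intros hol) (auto simp: complex_nonpos_Reals_iff)

text \<open>One \<open>T\<close> serves all starting points of norm at most \<open>M\<close>.
  Besides integrability this makes the segment between two shifted half lines negligible. The rate
  e^(-t) is only a convenient weakening of the Gaussian decay.\<close>

lemma G_decay:
  assumes w: "Re w > 2"
  shows "\<exists>T\<ge>1. \<forall>t\<ge>T. \<forall>a\<in>Sec. cmod a \<le> M \<longrightarrow> cmod (G w (a + of_real t)) \<le> exp (- t)"
proof (cases "M \<ge> 0")
  case M: True
  define C where "C = (1 + B) * exp (pi * \<bar>Im w\<bar>)"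
  have "C > 0" using B_nonneg by (simp add: C_def add_pos_nonneg)
  have lim: "((\<lambda>t. C * ((M + t) powr (Re w - 2) * ((M + t) * exp (- pi * (t\<^sup>2 - 2 * t * M - M\<^sup>2)))) * exp t) \<longlongrightarrow> 0) at_top"
    by real_asymp
  have "eventually (\<lambda>t. C * ((M + t) powr (Re w - 2) * ((M + t) * exp (- pi * (t\<^sup>2 - 2 * t * M - M\<^sup>2)))) * exp t < 1) at_top"
    using order_tendstoD(2)[OF lim, of 1] by simp
  then obtain T0 where T0: "\<And>t. t \<ge> T0 \<Longrightarrow> C * ((M + t) powr (Re w - 2) * ((M + t) * exp (- pi * (t\<^sup>2 - 2 * t * M - M\<^sup>2)))) * exp t < 1"
    by (auto simp: eventually_at_top_linorder)
  have le_exp_minus: "x \<le> exp (- t)" if "x * exp t < 1" for x t :: real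
    using that by (simp add: exp_minus field_simps)
  have "cmod (G w (a + of_real t)) \<le> exp (- t)" if t: "t \<ge> max 1 T0" and a: "a \<in> Sec" "cmod a \<le> M" for t a
  proof -
    define z where "z = a + of_real t"
    have V: "Re z + Im z \<ge> 1" using t Sec_nonneg[OF a(1)] by (simp add: z_def)
    have z0: "z \<noteq> 0" using V by auto
    have zM: "cmod z \<le> M + t" using a t norm_triangle_ineq[of a "of_real t"] by (simp add: z_def)
    have Mt: "M + t > 0" using M t by simp
    have "cmod (z powr (w - 2)) \<le> cmod z powr (Re w - 2) * exp (pi * \<bar>Im w\<bar>)"
      using norm_powr_complex_le[of z "w - 2"] by simp
    also have "\<dots> \<le> (M + t) powr (Re w - 2) * exp (pi * \<bar>Im w\<bar>)"
      using w zM by (intro mult_right_mono powr_mono2) auto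
    finally have 1: "cmod (z powr (w - 2)) \<le> (M + t) powr (Re w - 2) * exp (pi * \<bar>Im w\<bar>)" .
    have "cmod (K z) \<le> cmod z * (1 + B / (Re z + Im z))"
      using V by (intro norm_K_le) auto
    also have "\<dots> \<le> (M + t) * (1 + B)"
      using V B_nonneg zM Mt
      by (intro mult_mono add_mono) (auto simp: divide_le_eq mult_le_cancel_left1 intro!: add_nonneg_nonneg)
    finally have 2: "cmod (K z) \<le> (M + t) * (1 + B)" .
    have re: "\<bar>Re a\<bar> \<le> M" and im: "\<bar>Im a\<bar> \<le> M"
      using abs_Re_le_cmod[of a] abs_Im_le_cmod[of a] a by linarith+
    have "- (t * M) \<le> t * Re a"
      using mult_left_mono[of "- M" "Re a" t] re t by auto
    moreover have "(Re a)\<^sup>2 \<ge> 0" by simp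
    moreover have "(Im a)\<^sup>2 \<le> M\<^sup>2" using im by (simp add: abs_le_square_iff[symmetric])
    moreover have "Re (z\<^sup>2) = (Re a)\<^sup>2 + 2 * (t * Re a) + t\<^sup>2 - (Im a)\<^sup>2"
      by (simp add: z_def power2_eq_square algebra_simps)
    ultimately have "t\<^sup>2 - 2 * t * M - M\<^sup>2 \<le> Re (z\<^sup>2)"
      by linarith
    then have 3: "cmod (exp (- of_real pi * z\<^sup>2)) \<le> exp (- pi * (t\<^sup>2 - 2 * t * M - M\<^sup>2))"
      by (simp add: norm_exp_eq_Re)
    have "cmod (G w z) \<le> ((M + t) powr (Re w - 2) * exp (pi * \<bar>Im w\<bar>)) * ((M + t) * (1 + B)) * exp (- pi * (t\<^sup>2 - 2 * t * M - M\<^sup>2))"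
      unfolding G_def norm_mult using 1 2 3 Mt B_nonneg by (intro mult_mono) auto
    also have "\<dots> = C * ((M + t) powr (Re w - 2) * ((M + t) * exp (- pi * (t\<^sup>2 - 2 * t * M - M\<^sup>2))))"
      by (simp add: C_def)
    also have "\<dots> \<le> exp (- t)"
      using T0[of t] t le_exp_minus[of _ t] by auto
    finally show ?thesis by (simp add: z_def)
  qed
  then show ?thesis by (intro exI[of _ "max 1 T0"]) auto
next
  case False
  then show ?thesis using norm_ge_zero order_trans by (intro exI[of _ 1]) blast
qed

lemma continuous_on_G_line:
  assumes w: "Re w > 2" and a: "a \<in> Sec"
  shows "continuous_on {0..} (\<lambda>t. G w (a + of_real t))"
proof (rule continuous_on_compose2[OF continuous_on_G[OF w]])
  have "a + of_real t \<in> Sec" if "t \<ge> 0" for t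
    using Sec_add[OF a, of t] half_plane_subset_Sec a that by (cases "t = 0") auto
  then show "(\<lambda>t. a + of_real t) ` {0..} \<subseteq> Sec"
    by auto
qed (intro continuous_intros)

lemma set_integrable_G:
  assumes w: "Re w > 2" and a: "a \<in> Sec"
  shows "set_integrable lborel {0..} (\<lambda>t. G w (a + of_real t))"
proof -
  obtain T where T: "T \<ge> 1" "\<And>t. t \<ge> T \<Longrightarrow> cmod (G w (a + of_real t)) \<le> exp (- t)"
    using G_decay[OF w, of "cmod a"] a by blast
  have cont: "continuous_on {0..} (\<lambda>t. G w (a + of_real t))"
    by (rule continuous_on_G_line[OF w a])
  have 1: "set_integrable lborel {0..T} (\<lambda>t. G w (a + of_real t))"
    by (intro borel_integrable_atLeastAtMost' continuous_on_subset[OF cont]) auto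
  have exp: "set_integrable lborel {0<..} (\<lambda>t. exp (- t :: real))"
    using integrable_I0i_exp_mscale[of 1] by simp
  have 2: "set_integrable lborel {T..} (\<lambda>t. G w (a + of_real t))"
  proof (rule set_integrable_bound)
    show "set_integrable lborel {T..} (\<lambda>t. exp (- t :: real))"
      by (rule set_integrable_subset[OF exp]) (use T in auto)
    show "set_borel_measurable lborel {T..} (\<lambda>t. G w (a + of_real t))"
      using T borel_measurable_continuous_on_indicator[OF _ continuous_on_subset[OF cont, of "{T..}"]]
      by (auto simp: set_borel_measurable_def)
    show "AE x in lborel. x \<in> {T..} \<longrightarrow> cmod (G w (a + of_real x)) \<le> norm (exp (- x))"
      using T by auto
  qed
  have "set_integrable lborel ({0..T} \<union> {T..}) (\<lambda>t. G w (a + of_real t))"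
    by (intro set_integrable_Un 1 2) auto
  then show ?thesis by (rule set_integrable_subset) auto
qed

text \<open>This takes the place of Cauchy's theorem: \<open>L\<close> does not depend on
  \<open>a\<close>, so a change of the starting point costs a difference of values of
  \<open>H\<close>. Derivatives are taken within \<open>Sec\<close> because starting points may lie
  on its boundary segment.\<close>

lemma half_line_integral:
  assumes w: "Re w > 2"
  shows "\<exists>H L. (\<forall>z\<in>Sec. (H has_field_derivative G w z) (at z within Sec)) \<and>
           (\<forall>a\<in>Sec. (LBINT t:{0..}. G w (a + of_real t)) = L - H a)"
proof -
  \<comment> \<open>Holomorphy is known only in the interior; on a convex set continuity up to the
    boundary suffices for a primitive.\<close>
  obtain H where H: "\<And>z. z \<in> Sec \<Longrightarrow> (H has_field_derivative G w z) (at z within Sec)"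
  proof (rule holomorphic_convex_primitive[OF convex_Sec _ continuous_on_G[OF w], of "{}"])
    show "G w field_differentiable at z" if "z \<in> interior Sec - {}" for z
      using that holomorphic_on_G[of w] open_half_plane
      by (auto simp: interior_Sec holomorphic_on_open field_differentiable_def)
  qed auto
  have line: "a + of_real t \<in> Sec" if "a \<in> Sec" "t \<ge> 0" for a t
    using Sec_add[OF that(1), of t] half_plane_subset_Sec that by (cases "t = 0") auto
  have lim: "((\<lambda>T. H (a + of_real T)) \<longlongrightarrow> (LBINT t:{0..}. G w (a + of_real t)) + H a) at_top"
    if a: "a \<in> Sec" for a
  proof -
    have "((\<lambda>t. G w (a + of_real t)) has_integral (H (a + of_real T) - H (a + of_real 0))) {0..T}"
      if T: "T \<ge> 0" for T
    proof (rule fundamental_theorem_of_calculus[OF T])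
      fix x assume x: "x \<in> {0..T}"
      have "((\<lambda>t. a + of_real t) has_vector_derivative 1) (at x within {0..T})"
        by (auto intro!: derivative_eq_intros)
      moreover have "(H has_field_derivative G w (a + of_real x)) (at (a + of_real x) within (\<lambda>t. a + of_real t) ` {0..T})"
        by (rule has_field_derivative_subset[OF H]) (use line[OF a] x in auto)
      ultimately show "((\<lambda>t. H (a + of_real t)) has_vector_derivative G w (a + of_real x)) (at x within {0..T})"
        using field_vector_diff_chain_within[of "\<lambda>t. a + of_real t" 1 x "{0..T}" H "G w (a + of_real x)"]
        by (simp add: o_def)
    qed
    then have "integral {0..T} (\<lambda>t. G w (a + of_real t)) = H (a + of_real T) - H a" if "T \<ge> 0" for T
      using integral_unique that by fastforce
    moreover have "set_integrable lborel {0..T} (\<lambda>t. G w (a + of_real t))" for T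
      by (rule set_integrable_subset[OF set_integrable_G[OF w a]]) auto
    ultimately have "(LBINT t:{0..T}. G w (a + of_real t)) = H (a + of_real T) - H a" if "T \<ge> 0" for T
      using that by (simp add: set_borel_integral_eq_integral)
    then have ev: "\<forall>\<^sub>F T in at_top. (LBINT t:{0..T}. G w (a + of_real t)) + H a = H (a + of_real T)"
      by (intro eventually_at_top_linorderI[of 0]) auto
    have "((\<lambda>T. (LBINT t:{0..T}. G w (a + of_real t)) + H a) \<longlongrightarrow> (LBINT t:{0..}. G w (a + of_real t)) + H a) at_top"
      by (intro tendsto_intros tendsto_set_lebesgue_integral_at_top set_integrable_G[OF w a]) auto
    then show ?thesis
      by (rule Lim_transform_eventually[OF _ ev])
  qed
  \<comment> \<open>The limit of \<open>H\<close> along a half line is the same for every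
    \<open>a\<close>: the points a + T and T are joined by a segment of length |a|, all of whose
    points are c + T with c in \<open>Sec\<close> and |c| at most |a|, so \<open>G\<close> is at
    most e^(-T) on it.\<close>
  have "((\<lambda>T. H (a + of_real T) - H (0 + of_real T)) \<longlongrightarrow> 0) at_top" if a: "a \<in> Sec" for a
  proof -
    obtain T where T: "T \<ge> 1" "\<And>t c. t \<ge> T \<Longrightarrow> c \<in> Sec \<Longrightarrow> cmod c \<le> cmod a \<Longrightarrow> cmod (G w (c + of_real t)) \<le> exp (- t)"
      using G_decay[OF w, of "cmod a"] by blast
    have bound: "cmod (H (a + of_real t) - H (0 + of_real t)) \<le> exp (- t) * cmod a" if t: "t \<ge> T" for t
    proof -
      let ?S = "closed_segment (of_real t) (a + of_real t)"
      have S: "\<exists>c\<in>Sec. cmod c \<le> cmod a \<and> z = c + of_real t" if z: "z \<in> ?S" for z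
      proof -
        obtain u where u: "0 \<le> u" "u \<le> 1" "z = (1 - u) *\<^sub>R of_real t + u *\<^sub>R (a + of_real t)"
          using z by (auto simp: in_segment)
        have "(1 - u) *\<^sub>R 0 + u *\<^sub>R a \<in> Sec"
          using convex_Sec a u unfolding convex_alt by (metis zero_in_Sec)
        then show ?thesis
          using u by (intro bexI[of _ "u *\<^sub>R a"]) (auto simp: algebra_simps scaleR_conv_of_real norm_mult mult_left_le_one_le)
      qed
      have "cmod (H (a + of_real t) - H (of_real t)) \<le> exp (- t) * cmod (a + of_real t - of_real t)"
      proof (rule field_differentiable_bound[of ?S])
        show "(H has_field_derivative G w z) (at z within ?S)" if "z \<in> ?S" for z
          using S line T t by (intro has_field_derivative_subset[OF H]) (use that in fastforce)+
        show "cmod (G w z) \<le> exp (- t)" if "z \<in> ?S" for z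
          using S[OF that] T t by auto
      qed auto
      then show ?thesis by simp
    qed
    show ?thesis
    proof (rule Lim_null_comparison)
      show "\<forall>\<^sub>F t in at_top. cmod (H (a + of_real t) - H (0 + of_real t)) \<le> exp (- t) * cmod a"
        using bound by (rule eventually_at_top_linorderI)
      show "((\<lambda>t. exp (- t) * cmod a) \<longlongrightarrow> 0) at_top"
        by real_asymp
    qed
  qed
  then have "(LBINT t:{0..}. G w (a + of_real t)) + H a - ((LBINT t:{0..}. G w (0 + of_real t)) + H 0) = 0"
    if "a \<in> Sec" for a
    using tendsto_unique[OF _ tendsto_diff[OF lim[OF that] lim[OF zero_in_Sec]]] that by fastforce
  then have "\<forall>a\<in>Sec. (LBINT t:{0..}. G w (a + of_real t)) = (LBINT t:{0..}. G w (0 + of_real t)) + H 0 - H a"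
    by (metis add_diff_cancel_right' eq_iff_diff_eq_0)
  with H show ?thesis by blast
qed

end

section \<open>The exponent near the saddle point\<close>

lemma Re_ge_half_imp:
  assumes "Re z \<ge> 1 / 2"
  shows "z \<noteq> 0" "z \<notin> \<real>\<^sub>\<le>\<^sub>0"
  using assms by (auto simp: complex_nonpos_Reals_iff)

text \<open>The remainder has derivative -u^2/(1+u), and |1+u| is at least 1/2 on the segment. A
  bound on a whole half plane is needed, not just near 0, because s/\<omega> is unbounded along the
  ray.\<close>

lemma norm_Ln_1_plus_taylor2_le:
  assumes "Re z \<ge> - 1 / 2"
  shows "cmod (z - Ln (1 + z) - z\<^sup>2 / 2) \<le> 2 * cmod z ^ 3"
proof -
  let ?f = "\<lambda>z. z - Ln (1 + z) - z\<^sup>2 / 2"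
  have "cmod (?f z - ?f 0) \<le> 2 * (cmod z)\<^sup>2 * cmod (z - 0)"
  proof (rule field_differentiable_bound[of "closed_segment 0 z"])
    fix u assume "u \<in> closed_segment 0 z"
    then obtain t where t: "0 \<le> t" "t \<le> 1" "u = t *\<^sub>R z"
      by (auto simp: in_segment)
    have "t * Re z \<ge> - 1 / 2"
    proof (cases "Re z \<ge> 0")
      case True
      then have "t * Re z \<ge> 0" using t by simp
      then show ?thesis by linarith
    next
      case False
      then have "t * Re z \<ge> 1 * Re z" using t by (intro mult_right_mono_neg) auto
      then show ?thesis using assms by linarith
    qed
    then have re: "Re (1 + u) \<ge> 1 / 2" using t by simp
    note nz = Re_ge_half_imp[OF re]
    have "(?f has_field_derivative 1 - 1 / (1 + u) - u) (at u within closed_segment 0 z)"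
      using nz by (auto intro!: derivative_eq_intros simp: inverse_eq_divide)
    moreover have "1 - 1 / (1 + u) - u = - u\<^sup>2 / (1 + u)"
      using nz by (simp add: divide_simps power2_eq_square) (simp add: algebra_simps)
    ultimately show "(?f has_field_derivative - u\<^sup>2 / (1 + u)) (at u within closed_segment 0 z)"
      by simp
    have "cmod u \<le> cmod z" using t by (simp add: mult_left_le_one_le)
    moreover have "cmod (1 + u) \<ge> 1 / 2" using re complex_Re_le_cmod[of "1 + u"] by linarith
    ultimately have "(cmod u)\<^sup>2 / cmod (1 + u) \<le> (cmod z)\<^sup>2 / (1 / 2)"
      by (intro frac_le power_mono) auto
    then show "cmod (- u\<^sup>2 / (1 + u)) \<le> 2 * (cmod z)\<^sup>2"
      by (simp add: norm_divide norm_power)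
  qed auto
  then show ?thesis by (simp add: power3_eq_cube power2_eq_square)
qed

text \<open>The derivative of \<open>exp\<close> has norm at most 1 on the convex left half plane.
  Thus errors in the exponent pass to the integrand without a growth factor, even where they are
  large.\<close>

lemma norm_exp_diff_le:
  fixes x y :: complex
  assumes "Re x \<le> 0" "Re y \<le> 0"
  shows "cmod (exp x - exp y) \<le> cmod (x - y)"
proof -
  have "cmod (exp x - exp y) \<le> 1 * cmod (x - y)"
    by (rule field_differentiable_bound[of "{z. Re z \<le> 0}" exp exp])
       (use assms in \<open>auto intro!: derivative_eq_intros simp: convex_halfspace_Re_le norm_exp_eq_Re\<close>)
  then show ?thesis by simp
qed

lemma bounded_above_of_tendsto_0:
  fixes h :: "real \<Rightarrow> real"
  assumes "continuous_on {0..} h" "(h \<longlongrightarrow> 0) at_top"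
  shows "\<exists>C\<ge>0. \<forall>t\<ge>0. h t \<le> C"
proof -
  have "\<forall>\<^sub>F t in at_top. h t < 1"
    using order_tendstoD(2)[OF assms(2), of 1] by simp
  then obtain T where T: "\<And>t. t \<ge> T \<Longrightarrow> h t < 1"
    by (auto simp: eventually_at_top_linorder)
  have "compact (h ` {0..max 0 T})"
    by (intro compact_continuous_image continuous_on_subset[OF assms(1)]) auto
  then obtain M where M: "\<And>t. t \<in> {0..max 0 T} \<Longrightarrow> \<bar>h t\<bar> \<le> M"
    using compact_imp_bounded bounded_iff by (metis imageI real_norm_def)
  have "h t \<le> max 1 M" if "t \<ge> 0" for t
    using T[of t] M[of t] that by (cases "t \<le> max 0 T") (auto simp: max_def abs_le_iff split: if_splits)
  then show ?thesis by (intro exI[of _ "max 1 M"]) auto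
qed

text \<open>With \<open>w = 2\<pi> \<omega>^2\<close> this is \<open>w (\<zeta> - log (1 + \<zeta>))\<close> for \<open>\<zeta> = s/\<omega>\<close>, which is close to \<open>\<pi> s^2\<close>.\<close>

definition saddle_D :: "complex \<Rightarrow> real \<Rightarrow> complex" where
  "saddle_D \<omega> s = 2 * of_real pi * \<omega>\<^sup>2 * (of_real s / \<omega> - Ln (1 + of_real s / \<omega>))"

text \<open>The reason for leaving the ray at \<omega> - |\<omega>|/2: for negative s only
  |s/\<omega>| <= 1/2 is used, for positive s only Re \<omega> > 0, so 1 + s/\<omega> stays away
  from 0 whatever the argument of \<omega>.\<close>

lemma Re_saddle_ratio:
  assumes "0 < Re \<omega>" "- cmod \<omega> / 2 \<le> s"
  shows "Re (of_real s / \<omega>) \<ge> - 1 / 2"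
proof (cases "s \<ge> 0")
  case True
  then have "Re (of_real s / \<omega>) \<ge> 0" using assms by (simp add: Re_divide)
  then show ?thesis by linarith
next
  case False
  have "\<omega> \<noteq> 0" using assms by auto
  then have "cmod (of_real s / \<omega>) \<le> 1 / 2"
    using False assms by (simp add: norm_divide divide_simps)
  then show ?thesis using abs_Re_le_cmod[of "of_real s / \<omega>"] by linarith
qed

lemma Re_saddle_D:
  assumes \<omega>: "0 < Re \<omega>" and s: "- cmod \<omega> / 2 \<le> s"
  shows "Re (saddle_D \<omega> s) \<ge> 0"
proof -
  have \<omega>0: "\<omega> \<noteq> 0" using \<omega> by auto
  define d where "d x = Re (2 * of_real pi * of_real x / (1 + of_real x / \<omega>))" for x
  \<comment> \<open>Since \<open>d x\<close> has the sign of \<open>x\<close>, the minimum is at \<open>0\<close>.\<close>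
  have deriv: "((\<lambda>x. Re (saddle_D \<omega> x)) has_real_derivative d x) (at x)" if "- cmod \<omega> / 2 \<le> x" for x
  proof -
    have re: "Re (1 + of_real x / \<omega>) \<ge> 1 / 2" using Re_saddle_ratio[OF \<omega> that] by simp
    note nz = Re_ge_half_imp[OF re]
    then have nz': "\<omega> + of_real x \<noteq> 0" using \<omega>0 by (auto simp: field_simps)
    have "((\<lambda>z. 2 * of_real pi * \<omega>\<^sup>2 * (z / \<omega> - Ln (1 + z / \<omega>))) has_field_derivative
        2 * of_real pi * \<omega>\<^sup>2 * (1 / \<omega> - 1 / \<omega> / (1 + of_real x / \<omega>))) (at (of_real x))"
      using nz \<omega>0 by (auto intro!: derivative_eq_intros simp: inverse_eq_divide)
    moreover have "2 * of_real pi * \<omega>\<^sup>2 * (1 / \<omega> - 1 / \<omega> / (1 + of_real x / \<omega>)) =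
        2 * of_real pi * of_real x / (1 + of_real x / \<omega>)"
    proof -
      have "\<omega>\<^sup>2 * (1 / \<omega> - 1 / \<omega> / (1 + of_real x / \<omega>)) = of_real x / (1 + of_real x / \<omega>)"
        using nz' \<omega>0 by (simp add: divide_simps power2_eq_square)
      then show ?thesis by (metis mult.assoc times_divide_eq_right)
    qed
    ultimately have "((\<lambda>z. 2 * of_real pi * \<omega>\<^sup>2 * (z / \<omega> - Ln (1 + z / \<omega>))) has_field_derivative
        2 * of_real pi * of_real x / (1 + of_real x / \<omega>)) (at (of_real x))"
      by simp
    then show ?thesis
      unfolding saddle_D_def d_def
      using has_field_derivative_Re has_vector_derivative_real_field by blast
  qed
  have d: "d x = 2 * pi * x * (Re (1 + of_real x / \<omega>) / (cmod (1 + of_real x / \<omega>))\<^sup>2)" for x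
  proof -
    have "2 * of_real pi * of_real x / (1 + of_real x / \<omega>) = of_real (2 * pi * x) * inverse (1 + of_real x / \<omega>)"
      by (simp add: divide_inverse)
    then show ?thesis
      unfolding d_def by (simp add: cmod_power2)
  qed
  have pos: "Re (1 + of_real x / \<omega>) / (cmod (1 + of_real x / \<omega>))\<^sup>2 \<ge> 0" if "- cmod \<omega> / 2 \<le> x" for x
    using Re_saddle_ratio[OF \<omega> that] by (intro divide_nonneg_nonneg) auto
  have D0: "Re (saddle_D \<omega> 0) = 0" by (simp add: saddle_D_def)
  show ?thesis
  proof (cases "s \<ge> 0")
    case True
    have "Re (saddle_D \<omega> 0) \<le> Re (saddle_D \<omega> s)"
    proof (rule DERIV_nonneg_imp_nondecreasing[OF True, of "\<lambda>x. Re (saddle_D \<omega> x)"])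
      fix x assume x: "0 \<le> x" "x \<le> s"
      then have "- cmod \<omega> / 2 \<le> x" using norm_ge_zero[of \<omega>] by linarith
      moreover have "d x \<ge> 0" unfolding d
        using x pos[OF calculation] by (intro mult_nonneg_nonneg) auto
      ultimately show "\<exists>y. ((\<lambda>x. Re (saddle_D \<omega> x)) has_real_derivative y) (at x) \<and> 0 \<le> y"
        using deriv by blast
    qed
    then show ?thesis using D0 by simp
  next
    case False
    have "Re (saddle_D \<omega> 0) \<le> Re (saddle_D \<omega> s)"
    proof (rule DERIV_nonpos_imp_nonincreasing[of s 0 "\<lambda>x. Re (saddle_D \<omega> x)"])
      show "s \<le> 0" using False by simp
      fix x assume x: "s \<le> x" "x \<le> 0"
      then have "- cmod \<omega> / 2 \<le> x" using s by linarith
      moreover have "d x \<le> 0" unfolding d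
        by (rule mult_nonpos_nonneg) (use x pos[OF calculation] in \<open>auto simp: mult_nonneg_nonpos\<close>)
      ultimately show "\<exists>y. ((\<lambda>x. Re (saddle_D \<omega> x)) has_real_derivative y) (at x) \<and> y \<le> 0"
        using deriv by blast
    qed
    then show ?thesis using D0 by simp
  qed
qed

lemma norm_saddle_D_le:
  assumes \<omega>: "0 < Re \<omega>" and s: "- cmod \<omega> / 2 \<le> s"
  shows "cmod (saddle_D \<omega> s - of_real (pi * s\<^sup>2)) \<le> 4 * pi * \<bar>s\<bar> ^ 3 / cmod \<omega>"
proof -
  have \<omega>0: "\<omega> \<noteq> 0" using \<omega> by auto
  define z where "z = of_real s / \<omega>"
  have eq: "saddle_D \<omega> s - of_real (pi * s\<^sup>2) = 2 * of_real pi * \<omega>\<^sup>2 * (z - Ln (1 + z) - z\<^sup>2 / 2)"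
    using \<omega>0 by (simp add: saddle_D_def z_def field_simps power2_eq_square)
  have "cmod (saddle_D \<omega> s - of_real (pi * s\<^sup>2)) \<le> 2 * pi * (cmod \<omega>)\<^sup>2 * (2 * cmod z ^ 3)"
    unfolding eq norm_mult
    by (intro mult_mono norm_Ln_1_plus_taylor2_le)
       (use Re_saddle_ratio[OF assms] in \<open>auto simp: z_def norm_power\<close>)
  also have "\<dots> = 4 * pi * \<bar>s\<bar> ^ 3 / cmod \<omega>"
    using \<omega>0 by (simp add: z_def norm_divide field_simps power2_eq_square power3_eq_cube)
  finally show ?thesis .
qed

text \<open>Because \<omega> is a critical point, the cross term 2\<pi>\<omega>s of \<pi>z^2 equals
  w s/\<omega> and is absorbed into \<open>saddle_D\<close>. Only half of the limiting Gaussian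
  e^(-2\<pi> s^2) stays explicit; it serves as the dominating weight, and the other half is hidden
  in \<open>saddle_D\<close>.\<close>

lemma powr_exp_saddle:
  assumes \<omega>: "0 < Im \<omega>" "Im \<omega> < Re \<omega>" and s: "- cmod \<omega> / 2 \<le> s"
  defines "w \<equiv> 2 * of_real pi * \<omega>\<^sup>2" and "z \<equiv> \<omega> + of_real s"
  shows "z powr w * exp (- of_real pi * z\<^sup>2) =
         \<omega> powr w * exp (- of_real pi * \<omega>\<^sup>2) * exp (- of_real (pi * s\<^sup>2) - saddle_D \<omega> s)"
proof -
  have \<omega>0: "\<omega> \<noteq> 0" "0 < Re \<omega>" using \<omega> by auto
  have re: "Re (1 + of_real s / \<omega>) \<ge> 1 / 2" using Re_saddle_ratio[OF \<omega>0(2) s] by simp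
  note nz = Re_ge_half_imp(1)[OF re]
  have z: "z = \<omega> * (1 + of_real s / \<omega>)" using \<omega>0 by (simp add: z_def field_simps)
  have "z \<noteq> 0" using z nz \<omega>0 by simp
  \<comment> \<open>Both factors lie in the right half plane, so their arguments add up without
    crossing the branch cut.\<close>
  have "\<bar>Im (Ln \<omega>)\<bar> < pi / 2" "\<bar>Im (Ln (1 + of_real s / \<omega>))\<bar> < pi / 2"
    using \<omega>0 nz re Re_Ln_pos_lt[OF \<omega>0(1)] Re_Ln_pos_lt[OF nz] by simp_all
  then have Ln: "Ln z = Ln \<omega> + Ln (1 + of_real s / \<omega>)"
    unfolding z using \<omega>0 nz by (intro Ln_times_simple) auto
  have "w * Ln z - of_real pi * z\<^sup>2 = w * Ln \<omega> - of_real pi * \<omega>\<^sup>2 + (- of_real (pi * s\<^sup>2) - saddle_D \<omega> s)"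
    using \<omega>0 unfolding Ln by (simp add: w_def z_def saddle_D_def field_simps power2_eq_square)
  then show ?thesis
    using \<open>z \<noteq> 0\<close> \<omega>0 by (simp add: powr_def flip: exp_add)
qed

section \<open>The saddle point estimate\<close>

text \<open>The real part of \<open>b\<close> is removed by completing the square; the imaginary
  part turns the integral into the characteristic function of the standard normal
  distribution.\<close>

lemma integral_gaussian_linear:
  fixes b :: complex
  shows "(LINT s|lborel. exp (- of_real (2 * pi * s\<^sup>2) + b * of_real s)) = exp (b\<^sup>2 / (8 * of_real pi)) / of_real (sqrt 2)"
proof -
  define p q where "p = Re b" and "q = Im b"
  have b: "b = of_real p + \<i> * of_real q" by (simp add: p_def q_def complex_eq_iff)
  \<comment> \<open>In the substitution s = t + c x the shift \<open>t\<close> maximizes -2\<pi> s^2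
    + p s, and the scale \<open>c\<close> turns the quadratic part into x^2/2.\<close>
  define c where "c = 1 / (2 * sqrt pi)"
  define t where "t = p / (4 * pi)"
  have c: "c > 0" by (simp add: c_def)
  have c2: "c\<^sup>2 = 1 / (4 * pi)" by (simp add: c_def power2_eq_square)
  have pt: "pi * t = p / 4" by (simp add: t_def)
  have eq: "exp (- of_real (2 * pi * (t + c * x)\<^sup>2) + b * of_real (t + c * x)) =
      exp (of_real (p\<^sup>2 / (8 * pi)) + \<i> * of_real (q * t)) * of_real (sqrt (2 * pi)) * (std_normal_density x *\<^sub>R exp (\<i> * of_real (q * c * x)))" for x
  proof -
    have "2 * pi * (t + c * x)\<^sup>2 = 2 * (pi * t) * t + 4 * (pi * t) * c * x + 2 * pi * c\<^sup>2 * x\<^sup>2"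
      by (simp add: power2_eq_square algebra_simps)
    also have "\<dots> = p\<^sup>2 / (8 * pi) + p * c * x + x\<^sup>2 / 2"
      unfolding pt c2 by (simp add: t_def power2_eq_square)
    moreover have "p * t = p\<^sup>2 / (4 * pi)" by (simp add: t_def power2_eq_square)
    ultimately have "- of_real (2 * pi * (t + c * x)\<^sup>2) + b * of_real (t + c * x) =
      of_real (p\<^sup>2 / (8 * pi)) + \<i> * of_real (q * t) + of_real (- x\<^sup>2 / 2) + \<i> * of_real (q * c * x)"
      unfolding b by (simp add: complex_eq_iff algebra_simps)
    then have "exp (- of_real (2 * pi * (t + c * x)\<^sup>2) + b * of_real (t + c * x)) =
      exp (of_real (p\<^sup>2 / (8 * pi)) + \<i> * of_real (q * t)) * of_real (exp (- x\<^sup>2 / 2)) * exp (\<i> * of_real (q * c * x))"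
      by (simp only: exp_add exp_of_real)
    then show ?thesis
      by (simp add: std_normal_density_def scaleR_conv_of_real)
  qed
  have "(LINT x|lborel. std_normal_density x *\<^sub>R exp (\<i> * of_real (q * c * x))) = char std_normal_distribution (q * c)"
    unfolding char_def by (subst integral_density) (auto simp: mult_ac)
  also have "\<dots> = of_real (exp (- q\<^sup>2 / (8 * pi)))"
    by (simp add: char_std_normal_distribution power_mult_distrib c2)
  finally have ch: "(LINT x|lborel. std_normal_density x *\<^sub>R exp (\<i> * of_real (q * c * x))) = of_real (exp (- q\<^sup>2 / (8 * pi)))" .
  have "(LINT s|lborel. exp (- of_real (2 * pi * s\<^sup>2) + b * of_real s)) =
      \<bar>c\<bar> *\<^sub>R (LINT x|lborel. exp (- of_real (2 * pi * (t + c * x)\<^sup>2) + b * of_real (t + c * x)))"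
    using c by (intro lborel_integral_real_affine) auto
  also have "\<dots> = c *\<^sub>R (exp (of_real (p\<^sup>2 / (8 * pi)) + \<i> * of_real (q * t)) * of_real (sqrt (2 * pi)) * of_real (exp (- q\<^sup>2 / (8 * pi))))"
    unfolding eq integral_mult_right_zero ch using c by simp
  also have "\<dots> = of_real (c * sqrt (2 * pi)) * exp (of_real (p\<^sup>2 / (8 * pi)) + \<i> * of_real (q * t) + of_real (- q\<^sup>2 / (8 * pi)))"
    by (simp only: exp_add exp_of_real scaleR_conv_of_real of_real_mult mult_ac)
  also have "of_real (p\<^sup>2 / (8 * pi)) + \<i> * of_real (q * t) + of_real (- q\<^sup>2 / (8 * pi)) = b\<^sup>2 / (8 * of_real pi)"
    unfolding b t_def by (simp add: power2_eq_square field_simps)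
  also have "c * sqrt (2 * pi) = 1 / sqrt 2"
    by (simp add: c_def real_sqrt_mult field_simps)
  finally show ?thesis by simp
qed

text \<open>Since \<pi> > 1/2, splitting off e^(-s^2/2) leaves a bounded factor \<open>h\<close>, so
  a multiple of the standard normal density is a majorant.\<close>

lemma integrable_gaussian_cubic:
  fixes \<beta> p q d :: real
  shows "integrable lborel (\<lambda>s. exp (- pi * s\<^sup>2 + \<beta> * \<bar>s\<bar>) * (p * \<bar>s\<bar> ^ 3 + q * \<bar>s\<bar> + d))"
proof -
  define h where "h t = exp (- pi * t\<^sup>2 + \<beta> * t + t\<^sup>2 / 2) * (\<bar>p\<bar> * t ^ 3 + \<bar>q\<bar> * t + \<bar>d\<bar>)" for t
  have lim: "((\<lambda>t. exp (- pi * t\<^sup>2 + \<beta> * t + t\<^sup>2 / 2) * t ^ k) \<longlongrightarrow> 0) at_top" for k :: nat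
  proof -
    have "((\<lambda>t. exp (- pi * t\<^sup>2 + \<beta> * t + t\<^sup>2 / 2) * t ^ k) \<longlongrightarrow> 0) at_top"
      using pi_gt3 by real_asymp
    then show ?thesis .
  qed
  have "(h \<longlongrightarrow> \<bar>p\<bar> * 0 + \<bar>q\<bar> * 0 + \<bar>d\<bar> * 0) at_top"
    unfolding h_def
    using tendsto_add[OF tendsto_add[OF tendsto_mult_left[OF lim[of 3], of "\<bar>p\<bar>"] tendsto_mult_left[OF lim[of 1], of "\<bar>q\<bar>"]]
        tendsto_mult_left[OF lim[of 0], of "\<bar>d\<bar>"]]
    by (simp add: algebra_simps)
  moreover have "continuous_on {0..} h"
    unfolding h_def by (intro continuous_intros) auto
  ultimately obtain C where C: "C \<ge> 0" "\<And>t. t \<ge> 0 \<Longrightarrow> h t \<le> C"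
    using bounded_above_of_tendsto_0[of h] by auto
  show ?thesis
  proof (rule Bochner_Integration.integrable_bound)
    show "integrable lborel (\<lambda>s. (C * sqrt (2 * pi)) *\<^sub>R std_normal_density s)"
      by (intro integrable_scaleR_right integrable_normal_density) auto
    show "(\<lambda>s. exp (- pi * s\<^sup>2 + \<beta> * \<bar>s\<bar>) * (p * \<bar>s\<bar> ^ 3 + q * \<bar>s\<bar> + d)) \<in> borel_measurable lborel"
      by measurable
    show "AE s in lborel. norm (exp (- pi * s\<^sup>2 + \<beta> * \<bar>s\<bar>) * (p * \<bar>s\<bar> ^ 3 + q * \<bar>s\<bar> + d))
        \<le> norm ((C * sqrt (2 * pi)) *\<^sub>R std_normal_density s)"
    proof (rule AE_I2)
      fix s :: real
      have "\<bar>p * \<bar>s\<bar> ^ 3 + q * \<bar>s\<bar> + d\<bar> \<le> \<bar>p\<bar> * \<bar>s\<bar> ^ 3 + \<bar>q\<bar> * \<bar>s\<bar> + \<bar>d\<bar>"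
        by (rule order_trans[OF abs_triangle_ineq add_mono[OF order_trans[OF abs_triangle_ineq]]])
           (auto simp: abs_mult power_abs)
      then have "norm (exp (- pi * s\<^sup>2 + \<beta> * \<bar>s\<bar>) * (p * \<bar>s\<bar> ^ 3 + q * \<bar>s\<bar> + d))
          \<le> exp (- pi * s\<^sup>2 + \<beta> * \<bar>s\<bar>) * (\<bar>p\<bar> * \<bar>s\<bar> ^ 3 + \<bar>q\<bar> * \<bar>s\<bar> + \<bar>d\<bar>)"
        by (simp add: abs_mult)
      also have "\<dots> = h \<bar>s\<bar> * exp (- s\<^sup>2 / 2)"
      proof -
        have "exp (- pi * s\<^sup>2 + \<beta> * \<bar>s\<bar>) = exp (- pi * \<bar>s\<bar>\<^sup>2 + \<beta> * \<bar>s\<bar> + \<bar>s\<bar>\<^sup>2 / 2) * exp (- s\<^sup>2 / 2)"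
          by (simp flip: exp_add)
        then show ?thesis by (simp only: h_def mult_ac)
      qed
      also have "\<dots> \<le> C * exp (- s\<^sup>2 / 2)"
        using C by (intro mult_right_mono) auto
      also have "\<dots> = norm ((C * sqrt (2 * pi)) *\<^sub>R std_normal_density s)"
        using C by (simp add: std_normal_density_def abs_mult)
      finally show "norm (exp (- pi * s\<^sup>2 + \<beta> * \<bar>s\<bar>) * (p * \<bar>s\<bar> ^ 3 + q * \<bar>s\<bar> + d))
        \<le> norm ((C * sqrt (2 * pi)) *\<^sub>R std_normal_density s)" .
    qed
  qed
qed

section \<open>The horizontal ray, the initial segment, and the resulting asymptotics of
  \<open>J\<close>\<close>

context saddle_kernel
begin

text \<open>The integrand at the saddle point z = \<omega>, with the kernel replaced by its
  approximation e^(bz). The Gaussian constant is kept apart.\<close>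

definition saddle_main :: "complex \<Rightarrow> complex" where
  "saddle_main \<omega> = \<omega> powr (2 * of_real pi * \<omega>\<^sup>2) / \<omega> * exp (- of_real pi * \<omega>\<^sup>2) * exp (b * \<omega>)"

lemma G_saddle:
  assumes \<omega>: "0 < Im \<omega>" "Im \<omega> < Re \<omega>" and s: "- cmod \<omega> / 2 \<le> s"
  defines "z \<equiv> \<omega> + of_real s"
  shows "G (2 * of_real pi * \<omega>\<^sup>2) z = saddle_main \<omega> *
          (exp (- of_real (pi * s\<^sup>2) - saddle_D \<omega> s) * exp (b * of_real s) *
           (K z / z * exp (- (b * z)) / (1 + of_real s / \<omega>)))"
proof -
  have \<omega>0: "\<omega> \<noteq> 0" "0 < Re \<omega>" using \<omega> by auto
  have "Re (1 + of_real s / \<omega>) \<ge> 1 / 2" using Re_saddle_ratio[OF \<omega>0(2) s] by simp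
  note nz = Re_ge_half_imp(1)[OF this]
  have z: "z = \<omega> * (1 + of_real s / \<omega>)" using \<omega>0 by (simp add: z_def field_simps)
  then have z0: "z \<noteq> 0" using nz \<omega>0 by simp
  let ?w = "2 * of_real pi * \<omega>\<^sup>2"
  have "z powr (?w - 2) = z powr ?w / z\<^sup>2"
    using z0 powr_nat'[of z 2] by (simp add: powr_diff)
  then have "G ?w z = (z powr ?w * exp (- of_real pi * z\<^sup>2)) * K z / z\<^sup>2"
    by (simp add: G_def)
  also have "\<dots> = (\<omega> powr ?w * exp (- of_real pi * \<omega>\<^sup>2) * exp (- of_real (pi * s\<^sup>2) - saddle_D \<omega> s)) * K z / z\<^sup>2"
    unfolding z_def powr_exp_saddle[OF assms(1-3)] ..
  also have "\<dots> = (\<omega> powr ?w * exp (- of_real pi * \<omega>\<^sup>2) * exp (- of_real (pi * s\<^sup>2) - saddle_D \<omega> s)) * (K z / z) * (1 / z)"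
    by (simp add: power2_eq_square)
  also have "1 / z = 1 / \<omega> / (1 + of_real s / \<omega>)"
    unfolding z by simp
  also have "K z / z = K z / z * exp (- (b * z)) * exp (b * z)"
    by (simp add: exp_minus)
  also have "exp (b * z) = exp (b * \<omega>) * exp (b * of_real s)"
    by (simp add: z_def ring_distribs exp_add)
  finally show ?thesis
    by (simp add: saddle_main_def mult_ac)
qed

lemma saddle_main_nonzero: "\<omega> \<noteq> 0 \<Longrightarrow> saddle_main \<omega> \<noteq> 0"
  by (simp add: saddle_main_def)

text \<open>The ray integral is compared with the Gaussian over the whole real line. The pointwise
  error is at most \<open>W s\<close> / |\<omega>| relative to \<open>saddle_main\<close>, with an
  integrable \<open>W\<close> that does not depend on \<omega>; this covers the missing tail s <
  -|\<omega>|/2 as well.\<close>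

lemma J_saddle_line:
  "\<exists>C\<ge>0. \<forall>\<omega>. 0 < Im \<omega> \<longrightarrow> Im \<omega> < Re \<omega> \<longrightarrow> 1 \<le> cmod \<omega> \<longrightarrow> 2 < Re (2 * of_real pi * \<omega>\<^sup>2) \<longrightarrow>
     cmod ((LBINT t:{0..}. G (2 * of_real pi * \<omega>\<^sup>2) (\<omega> - of_real (cmod \<omega> / 2) + of_real t))
       - saddle_main \<omega> * (exp (b\<^sup>2 / (8 * of_real pi)) / of_real (sqrt 2))) \<le> C / cmod \<omega> * cmod (saddle_main \<omega>)"
proof -
  \<comment> \<open>The cubic term is the error 4\<pi>|s|^3/r of the exponent times the bound
    2(1+2B) for \<open>m / y\<close>; the other two terms are the error of \<open>m / y\<close>
    itself. The exponential is one Gaussian factor together with a bound for |e^(bs)|.\<close>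
  define W where "W s = exp (- pi * s\<^sup>2 + cmod b * \<bar>s\<bar>) * (8 * pi * (1 + 2 * B) * \<bar>s\<bar> ^ 3 + 2 * \<bar>s\<bar> + 4 * B)" for s
  have W_int: "integrable lborel W"
    unfolding W_def by (rule integrable_gaussian_cubic)
  have W_nonneg: "W s \<ge> 0" for s
    unfolding W_def using B_nonneg by (intro mult_nonneg_nonneg add_nonneg_nonneg) auto
  define Q0 where "Q0 s = exp (- of_real (2 * pi * s\<^sup>2) + b * of_real s)" for s :: real
  have norm_Q0: "cmod (Q0 s) \<le> exp (- pi * s\<^sup>2 + cmod b * \<bar>s\<bar>) * exp (- pi * s\<^sup>2)" for s
  proof -
    have "Re (b * of_real s) \<le> cmod b * \<bar>s\<bar>"
      using complex_Re_le_cmod[of "b * of_real s"] by (simp add: norm_mult)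
    then show ?thesis by (simp add: Q0_def norm_exp_eq_Re flip: exp_add)
  qed
  have Q0_int: "integrable lborel Q0"
  proof (rule Bochner_Integration.integrable_bound)
    show "integrable lborel (\<lambda>s. exp (- pi * s\<^sup>2 + cmod b * \<bar>s\<bar>) * (0 * \<bar>s\<bar> ^ 3 + 0 * \<bar>s\<bar> + 1))"
      by (rule integrable_gaussian_cubic)
    show "Q0 \<in> borel_measurable lborel"
      unfolding Q0_def by measurable
    show "AE s in lborel. norm (Q0 s) \<le> norm (exp (- pi * s\<^sup>2 + cmod b * \<bar>s\<bar>) * (0 * \<bar>s\<bar> ^ 3 + 0 * \<bar>s\<bar> + 1))"
    proof (rule AE_I2)
      fix s
      have "exp (- pi * s\<^sup>2 + cmod b * \<bar>s\<bar>) * exp (- pi * s\<^sup>2) \<le> exp (- pi * s\<^sup>2 + cmod b * \<bar>s\<bar>)"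
        by (intro mult_left_le) auto
      then show "norm (Q0 s) \<le> norm (exp (- pi * s\<^sup>2 + cmod b * \<bar>s\<bar>) * (0 * \<bar>s\<bar> ^ 3 + 0 * \<bar>s\<bar> + 1))"
        using order_trans[OF norm_Q0] by simp
    qed
  qed
  have main: "cmod ((LBINT t:{0..}. G (2 * of_real pi * \<omega>\<^sup>2) (\<omega> - of_real (cmod \<omega> / 2) + of_real t))
       - saddle_main \<omega> * (exp (b\<^sup>2 / (8 * of_real pi)) / of_real (sqrt 2))) \<le> (LINT s|lborel. W s) / cmod \<omega> * cmod (saddle_main \<omega>)"
    if \<omega>: "0 < Im \<omega>" "Im \<omega> < Re \<omega>" and r: "1 \<le> cmod \<omega>" and w: "2 < Re (2 * of_real pi * \<omega>\<^sup>2)" for \<omega>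
  proof -
    define r where "r = cmod \<omega>"
    define w where "w = 2 * of_real pi * \<omega>\<^sup>2"
    have r1: "r \<ge> 1" using r by (simp add: r_def)
    have V\<omega>: "Re \<omega> + Im \<omega> \<ge> r"
      using \<omega> cmod_le[of \<omega>] by (simp add: r_def)
    define F where "F s = indicator {-r/2..} s *\<^sub>R G w (\<omega> + of_real s)" for s :: real
    have a: "\<omega> - of_real (r / 2) \<in> Sec"
      using V\<omega> r1 by (auto simp: Sec_def)
    have F_shift: "F (- r / 2 + 1 * t) = indicator {0..} t *\<^sub>R G w (\<omega> - of_real (r / 2) + of_real t)" for t
      by (simp add: F_def indicator_def algebra_simps)
    have F_int: "integrable lborel F"
      using set_integrable_G[OF w a] lborel_integrable_real_affine_iff[of 1 F "- r / 2"]
      unfolding F_shift set_integrable_def w_def by simp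
    have "(LINT s|lborel. F s) = \<bar>1\<bar> *\<^sub>R (LINT t|lborel. F (- r / 2 + 1 * t))"
      by (rule lborel_integral_real_affine) auto
    then have F_eq: "(LBINT t:{0..}. G w (\<omega> - of_real (r / 2) + of_real t)) = (LINT s|lborel. F s)"
      unfolding F_shift set_lebesgue_integral_def by simp
    have pw: "cmod (F s - saddle_main \<omega> * Q0 s) \<le> cmod (saddle_main \<omega>) * (W s / r)" for s
    proof (cases "- r / 2 \<le> s")
      case False
      \<comment> \<open>Outside the path |s| > r/2, so the factor 1/r is gained by paying 2|s|,
        which \<open>W\<close> contains.\<close>
      then have s: "1 \<le> 2 * \<bar>s\<bar> / r" using r1 by (simp add: divide_simps)
      have "cmod (Q0 s) \<le> exp (- pi * s\<^sup>2 + cmod b * \<bar>s\<bar>) * exp (- pi * s\<^sup>2)"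
        by (rule norm_Q0)
      also have "\<dots> \<le> exp (- pi * s\<^sup>2 + cmod b * \<bar>s\<bar>) * (2 * \<bar>s\<bar> / r)"
        using s by (intro mult_left_mono) (auto intro: order_trans[of _ 1])
      also have "\<dots> \<le> W s / r"
        unfolding W_def times_divide_eq_right using r1 B_nonneg
        by (intro divide_right_mono mult_left_mono) auto
      finally have "cmod (saddle_main \<omega>) * cmod (Q0 s) \<le> cmod (saddle_main \<omega>) * (W s / r)"
        by (intro mult_left_mono) auto
      then show ?thesis
        using False by (simp add: F_def norm_mult)
    next
      case True
      define z where "z = \<omega> + of_real s"
      define D where "D = saddle_D \<omega> s"
      define m where "m = K z / z * exp (- (b * z))"
      define y where "y = 1 + of_real s / \<omega>"
      have \<omega>0: "\<omega> \<noteq> 0" "0 < Re \<omega>" using \<omega> by auto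
      have s: "- cmod \<omega> / 2 \<le> s" using True by (simp add: r_def)
      have y: "Re y \<ge> 1 / 2" using Re_saddle_ratio[OF \<omega>0(2) s] by (simp add: y_def)
      then have ny: "cmod y \<ge> 1 / 2" using complex_Re_le_cmod[of y] by linarith
      have V: "Re z + Im z \<ge> r / 2" using V\<omega> True by (simp add: z_def)
      have m1: "cmod (m - 1) \<le> 2 * B / r"
      proof -
        have "cmod (m - 1) \<le> B / (Re z + Im z)"
          unfolding m_def using V r1 by (intro asymp) auto
        also have "\<dots> \<le> B / (r / 2)"
          using V r1 B_nonneg by (intro divide_left_mono) (auto intro!: mult_pos_pos)
        finally show ?thesis by (simp add: mult.commute)
      qed
      also have "\<dots> \<le> 2 * B" using r1 B_nonneg by (simp add: divide_le_eq mult_le_cancel_left1)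
      finally have m2: "cmod m \<le> 1 + 2 * B"
        using norm_triangle_ineq2[of m 1] by simp
      have my: "cmod (m / y) \<le> 2 * (1 + 2 * B)"
      proof -
        have "cmod m / cmod y \<le> (1 + 2 * B) / (1 / 2)"
          using m2 ny B_nonneg by (intro frac_le) auto
        then show ?thesis by (simp add: norm_divide)
      qed
      have my1: "cmod (m / y - 1) \<le> (4 * B + 2 * \<bar>s\<bar>) / r"
      proof -
        have "y \<noteq> 0" using ny by auto
        then have "m / y - 1 = (m - y) / y"
          by (simp add: diff_divide_distrib)
        also have "m - y = (m - 1) - of_real s / \<omega>"
          by (simp add: y_def)
        finally have "cmod (m / y - 1) = cmod ((m - 1) - of_real s / \<omega>) / cmod y"
          by (simp add: norm_divide)
        also have "\<dots> \<le> (2 * B / r + \<bar>s\<bar> / r) / (1 / 2)"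
          using m1 ny norm_triangle_ineq4[of "m - 1" "of_real s / \<omega>"] r1 B_nonneg
          by (intro frac_le) (auto simp: norm_divide r_def)
        also have "\<dots> = (4 * B + 2 * \<bar>s\<bar>) / r"
          by (simp add: add_divide_distrib)
        finally show ?thesis .
      qed
      have D1: "cmod (exp (- D) - exp (- of_real (pi * s\<^sup>2))) \<le> 4 * pi * \<bar>s\<bar> ^ 3 / r"
      proof -
        have "cmod (exp (- D) - exp (- of_real (pi * s\<^sup>2))) \<le> cmod (- D - - of_real (pi * s\<^sup>2))"
          using Re_saddle_D[OF \<omega>0(2) s] by (intro norm_exp_diff_le) (auto simp: D_def)
        also have "\<dots> = cmod (D - of_real (pi * s\<^sup>2))"
          by (simp add: norm_minus_commute)
        also have "\<dots> \<le> 4 * pi * \<bar>s\<bar> ^ 3 / r"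
          unfolding D_def r_def by (rule norm_saddle_D_le[OF \<omega>0(2) s])
        finally show ?thesis .
      qed
      \<comment> \<open>Of the two factors e^(-\<pi> s^2) in \<open>Q0\<close> one stays outside as
        the weight; the other is compared with exp (- D).\<close>
      define e where "e = exp (- of_real (pi * s\<^sup>2) :: complex)"
      have ne: "cmod e \<le> 1" by (simp add: e_def norm_exp_eq_Re)
      have "cmod (exp (- D) * (m / y) - e) = cmod ((exp (- D) - e) * (m / y) + e * (m / y - 1))"
        by (simp add: algebra_simps)
      also have "\<dots> \<le> cmod (exp (- D) - e) * cmod (m / y) + cmod e * cmod (m / y - 1)"
        by (metis norm_mult norm_triangle_ineq)
      also have "\<dots> \<le> (4 * pi * \<bar>s\<bar> ^ 3 / r) * (2 * (1 + 2 * B)) + 1 * ((4 * B + 2 * \<bar>s\<bar>) / r)"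
        using D1 my ne my1 r1 B_nonneg unfolding e_def
        by (intro add_mono mult_mono) auto
      also have "\<dots> = (8 * pi * (1 + 2 * B) * \<bar>s\<bar> ^ 3 + 2 * \<bar>s\<bar> + 4 * B) / r"
        by (simp add: add_divide_distrib algebra_simps)
      finally have core: "cmod (exp (- D) * (m / y) - e) \<le> (8 * pi * (1 + 2 * B) * \<bar>s\<bar> ^ 3 + 2 * \<bar>s\<bar> + 4 * B) / r" .
      have "F s = saddle_main \<omega> * (e * exp (- D) * exp (b * of_real s) * (m / y))"
      proof -
        have "exp (- of_real (pi * s\<^sup>2) - D) = e * exp (- D)"
          unfolding e_def exp_add[symmetric] by simp
        then show ?thesis
          using True G_saddle[OF \<omega> s, folded w_def z_def D_def, folded m_def y_def]
          by (simp add: F_def z_def)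
      qed
      moreover have "Q0 s = e * e * exp (b * of_real s)"
        unfolding Q0_def e_def exp_add[symmetric] by (simp add: mult.assoc)
      ultimately have "F s - saddle_main \<omega> * Q0 s = saddle_main \<omega> * (e * exp (b * of_real s) * (exp (- D) * (m / y) - e))"
        by (simp add: algebra_simps)
      then have "cmod (F s - saddle_main \<omega> * Q0 s) = cmod (saddle_main \<omega>) * (cmod (e * exp (b * of_real s)) * cmod (exp (- D) * (m / y) - e))"
        by (simp add: norm_mult)
      also have "\<dots> \<le> cmod (saddle_main \<omega>) * (exp (- pi * s\<^sup>2 + cmod b * \<bar>s\<bar>) * ((8 * pi * (1 + 2 * B) * \<bar>s\<bar> ^ 3 + 2 * \<bar>s\<bar> + 4 * B) / r))"
      proof (intro mult_left_mono mult_mono core)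
        have "Re (b * of_real s) \<le> cmod b * \<bar>s\<bar>"
          using complex_Re_le_cmod[of "b * of_real s"] by (simp add: norm_mult)
        then show "cmod (e * exp (b * of_real s)) \<le> exp (- pi * s\<^sup>2 + cmod b * \<bar>s\<bar>)"
          by (simp add: e_def norm_mult norm_exp_eq_Re flip: exp_add)
      qed auto
      also have "\<dots> = cmod (saddle_main \<omega>) * (W s / r)"
        by (simp add: W_def)
      finally show ?thesis .
    qed
    have Q0_I: "(LINT s|lborel. Q0 s) = exp (b\<^sup>2 / (8 * of_real pi)) / of_real (sqrt 2)"
      unfolding Q0_def by (rule integral_gaussian_linear)
    have "(LINT s|lborel. F s) - saddle_main \<omega> * (LINT s|lborel. Q0 s) = (LINT s|lborel. F s - saddle_main \<omega> * Q0 s)"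
      using F_int Q0_int by simp
    also have "cmod \<dots> \<le> (LINT s|lborel. cmod (saddle_main \<omega>) * (W s / r))"
      using F_int Q0_int W_int pw
      by (intro Bochner_Integration.integral_norm_bound_integral) auto
    also have "\<dots> = (LINT s|lborel. W s) / r * cmod (saddle_main \<omega>)"
      by simp
    finally show ?thesis
      using F_eq Q0_I by (simp add: r_def w_def)
  qed
  show ?thesis
    by (intro exI[of _ "LINT s|lborel. W s"] conjI allI impI main)
       (use W_nonneg in \<open>auto intro: Bochner_Integration.integral_nonneg\<close>)
qed

text \<open>On the segment from 0 to z = \<omega> - |\<omega>|/2 the integrand is at most a constant
  times N/|z|, where N belongs to the endpoint z. There the factor e^(-\<pi>|\<omega>|^2/4) makes N
  far smaller than the saddle value.\<close>

lemma J_saddle_ray: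
  "\<exists>C\<ge>0. \<forall>\<omega> H. 0 < Im \<omega> \<longrightarrow> Im \<omega> < Re \<omega> \<longrightarrow> 1 \<le> cmod \<omega> \<longrightarrow> 2 < Re (2 * of_real pi * \<omega>\<^sup>2) \<longrightarrow>
     (\<forall>z\<in>Sec. (H has_field_derivative G (2 * of_real pi * \<omega>\<^sup>2) z) (at z within Sec)) \<longrightarrow>
     cmod (H (\<omega> - of_real (cmod \<omega> / 2)) - H 0) \<le> C / cmod \<omega> * cmod (saddle_main \<omega>)"
proof -
  \<comment> \<open>Boundedness of \<open>h\<close> says that the Gaussian loss e^(-\<pi> t^2/4)
    outweighs the lower bound e^(-|b|t) for |e^(b\<omega>)|. One factor t compensates the 1/\<omega>
    in \<open>saddle_main\<close>, the other yields the error 1/|\<omega>|.\<close>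
  define h where "h t = t\<^sup>2 * exp (cmod b * t - pi * t\<^sup>2 / 4)" for t :: real
  have "(h \<longlongrightarrow> 0) at_top"
    unfolding h_def by real_asymp
  moreover have "continuous_on {0..} h"
    unfolding h_def by (intro continuous_intros) auto
  ultimately obtain C where C: "C \<ge> 0" "\<And>t. t \<ge> 0 \<Longrightarrow> h t \<le> C"
    using bounded_above_of_tendsto_0[of h] by auto
  have main: "cmod (H (\<omega> - of_real (cmod \<omega> / 2)) - H 0) \<le> ((1 + 2 * B) * C) / cmod \<omega> * cmod (saddle_main \<omega>)"
    if \<omega>: "0 < Im \<omega>" "Im \<omega> < Re \<omega>" and r: "1 \<le> cmod \<omega>" and w: "2 < Re (2 * of_real pi * \<omega>\<^sup>2)"
      and H: "\<forall>z\<in>Sec. (H has_field_derivative G (2 * of_real pi * \<omega>\<^sup>2) z) (at z within Sec)" for \<omega> H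
  proof -
    define r where "r = cmod \<omega>"
    define w where "w = 2 * of_real pi * \<omega>\<^sup>2"
    define z where "z = \<omega> - of_real (r / 2)"
    define N where "N = cmod (z powr w * exp (- of_real pi * z\<^sup>2))"
    have r1: "r \<ge> 1" using r by (simp add: r_def)
    have \<sigma>: "Re w > 2" using w by (simp add: w_def)
    have V\<omega>: "Re \<omega> + Im \<omega> \<ge> r"
      using \<omega> cmod_le[of \<omega>] by (simp add: r_def)
    have V: "Re z + Im z \<ge> r / 2" using V\<omega> by (simp add: z_def)
    then have V': "Re z + Im z \<ge> 1 / 2" using r1 by linarith
    have z0: "z \<noteq> 0" using V' by auto
    \<comment> \<open>From Im \<omega> < Re \<omega> comes Re \<omega> >= r / sqrt 2 >= 7r/10, and
      7/10 - 1/4 = 9/20.\<close>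
    have key: "9 / 20 \<le> r * (Re \<omega> - r / 4)"
    proof -
      have "r = sqrt ((Re \<omega>)\<^sup>2 + (Im \<omega>)\<^sup>2)" by (simp add: r_def cmod_def)
      also have "\<dots> \<le> sqrt (2 * (Re \<omega>)\<^sup>2)"
        using \<omega>(1,2) power_mono[of "Im \<omega>" "Re \<omega>" 2] by (intro real_sqrt_le_mono) auto
      also have "\<dots> = sqrt 2 * Re \<omega>" using \<omega>(1,2) by (simp add: real_sqrt_mult)
      also have "\<dots> \<le> 10 / 7 * Re \<omega>"
        using \<omega>(1,2) by (intro mult_right_mono real_le_lsqrt) (simp_all add: power2_eq_square)
      finally have "7 / 10 * r \<le> Re \<omega>" by simp
      then have "1 * (9 / 20) \<le> r * (Re \<omega> - r / 4)" using r1 by (intro mult_mono) auto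
      then show ?thesis by simp
    qed
    have norm_powr_exp: "cmod (u powr w * exp (- of_real pi * u\<^sup>2)) = exp (Re (w * Ln u) - pi * Re (u\<^sup>2))"
      if "u \<noteq> 0" for u
      using that by (simp add: powr_def norm_exp_eq_Re flip: exp_add)
    have bound: "cmod (G w (of_real x * z)) \<le> N * (1 + 2 * B) / cmod z" if x: "0 < x" "x \<le> 1" for x
    proof -
      define y where "y = of_real x * z"
      have y0: "y \<noteq> 0" using x z0 by (simp add: y_def)
      have Vy: "Re y + Im y = x * (Re z + Im z)" by (simp add: y_def algebra_simps)
      have Vy_pos: "Re y + Im y > 0" unfolding Vy using x V' by (intro mult_pos_pos) auto
      define P where "P = Re (z\<^sup>2)"
      have Ln: "Ln y = of_real (ln x) + Ln z"
        unfolding y_def using x z0 by (simp add: Ln_times_of_real Ln_of_real)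
      have "Re (y\<^sup>2) = x\<^sup>2 * P"
        by (simp add: y_def P_def power2_eq_square algebra_simps)
      then have 1: "cmod (y powr w * exp (- of_real pi * y\<^sup>2)) = N * exp (Re w * ln x + pi * P * (1 - x\<^sup>2))"
        unfolding N_def norm_powr_exp[OF y0] norm_powr_exp[OF z0] exp_add[symmetric] Ln
        by (simp add: P_def algebra_simps)
      \<comment> \<open>The target x^2 compensates the factor y^(-2) in \<open>G\<close>, as
        \<open>K\<close> need not vanish at 0. For P <= 0 the Gaussian part already helps and Re w >
        2 suffices. For P > 0 the bound 1 - x^2 <= -2 ln x reduces the claim to Re w - 2\<pi>P >= 2,
        which \<open>key\<close> provides.\<close>
      have "Re w * ln x + pi * P * (1 - x\<^sup>2) \<le> 2 * ln x"
      proof (cases "P \<le> 0")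
        case True
        have "x\<^sup>2 \<le> 1" using x by (simp add: power_le_one)
        then have "pi * P * (1 - x\<^sup>2) \<le> 0"
          using True mult_nonpos_nonneg[of "pi * P" "1 - x\<^sup>2"] by (simp add: mult_nonneg_nonpos)
        moreover have "(Re w - 2) * ln x \<le> 0"
          using \<sigma> x by (intro mult_nonneg_nonpos) auto
        ultimately show ?thesis by (simp add: algebra_simps)
      next
        case False
        have "ln (x\<^sup>2) \<le> x\<^sup>2 - 1" using x by (intro ln_le_minus_one) auto
        then have "1 - x\<^sup>2 \<le> - 2 * ln x" using x by (simp add: ln_realpow)
        then have "pi * P * (1 - x\<^sup>2) \<le> pi * P * (- 2 * ln x)"
          using False by (intro mult_left_mono) auto
        moreover have "(Re w - 2 * pi * P - 2) * ln x \<le> 0"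
        proof (intro mult_nonneg_nonpos)
          have "Re w - 2 * pi * P = 2 * pi * (r * (Re \<omega> - r / 4))"
            by (simp add: w_def P_def z_def power2_eq_square algebra_simps)
          moreover have "3 * (9 / 20) \<le> pi * (r * (Re \<omega> - r / 4))"
            using key pi_gt3 by (intro mult_mono) auto
          ultimately show "0 \<le> Re w - 2 * pi * P - 2" by simp
        qed (use x in auto)
        ultimately show ?thesis by (simp add: algebra_simps)
      qed
      then have "exp (Re w * ln x + pi * P * (1 - x\<^sup>2)) \<le> x\<^sup>2"
        using x exp_le_cancel_iff[of "Re w * ln x + pi * P * (1 - x\<^sup>2)" "2 * ln x"]
        by (simp only: exp_double exp_ln)
      then have 2: "cmod (y powr w * exp (- of_real pi * y\<^sup>2)) \<le> N * x\<^sup>2"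
        unfolding 1 by (intro mult_left_mono) (auto simp: N_def)
      have "y powr (w - 2) = y powr w / y\<^sup>2"
        using y0 powr_nat'[of y 2] by (simp add: powr_diff)
      then have "cmod (G w y) = cmod (y powr w * exp (- of_real pi * y\<^sup>2)) * cmod (K y) / (cmod y)\<^sup>2"
        by (simp add: G_def norm_mult norm_divide norm_power)
      also have "\<dots> \<le> (N * x\<^sup>2) * (cmod y * (1 + B / (Re y + Im y))) / (cmod y)\<^sup>2"
        using norm_K_le[OF Vy_pos] 2 by (intro divide_right_mono mult_mono) (auto simp: N_def)
      also have "\<dots> = N * (x + B / (Re z + Im z)) / cmod z"
      proof -
        have "(n * x\<^sup>2) * ((x * c) * (1 + B / (x * v))) / (x * c)\<^sup>2 = n * (x + B / v) / c"
          if "c > 0" "v > 0" for n c v :: real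
          using that x by (simp add: divide_simps power2_eq_square)
        moreover have "cmod y = x * cmod z" using x by (simp add: y_def norm_mult)
        ultimately show ?thesis using z0 V' unfolding Vy by simp
      qed
      also have "\<dots> \<le> N * (1 + 2 * B) / cmod z"
      proof (intro divide_right_mono mult_left_mono add_mono)
        have "B / (Re z + Im z) \<le> B / (1 / 2)"
          using V' B_nonneg by (intro divide_left_mono) (auto intro!: mult_pos_pos)
        then show "B / (Re z + Im z) \<le> 2 * B" by simp
      qed (use x in \<open>auto simp: N_def\<close>)
      finally show ?thesis by (simp add: y_def)
    qed
    have seg: "closed_segment 0 z \<subseteq> Sec"
      using V' half_plane_subset_Sec by (intro closed_segment_subset convex_Sec) auto
    have "cmod (H z - H 0) \<le> (N * (1 + 2 * B) / cmod z) * cmod (z - 0)"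
    proof (rule field_differentiable_bound[of "closed_segment 0 z"])
      fix u assume u: "u \<in> closed_segment 0 z"
      then show "(H has_field_derivative G w u) (at u within closed_segment 0 z)"
        using H seg has_field_derivative_subset unfolding w_def by blast
      obtain x where x: "0 \<le> x" "x \<le> 1" "u = of_real x * z"
        using u by (auto simp: in_segment scaleR_conv_of_real)
      show "cmod (G w u) \<le> N * (1 + 2 * B) / cmod z"
        using bound[of x] x B_nonneg by (cases "x = 0") (auto simp: N_def)
    qed auto
    then have "cmod (H z - H 0) \<le> N * (1 + 2 * B)" using z0 by simp
    also have "N * (1 + 2 * B) \<le> ((1 + 2 * B) * C) / r * cmod (saddle_main \<omega>)"
    proof -
      define A where "A = cmod (\<omega> powr w * exp (- of_real pi * \<omega>\<^sup>2))"
      have A0: "A \<ge> 0" by (simp add: A_def)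
      have s: "- cmod \<omega> / 2 \<le> - r / 2" by (simp add: r_def)
      have \<omega>0: "0 < Re \<omega>" using \<omega> by simp
      \<comment> \<open>The factorization around the saddle, evaluated at the lower end s = -r/2 of
        the ray.\<close>
      have "N = A * exp (- (pi * (- r / 2)\<^sup>2) - Re (saddle_D \<omega> (- r / 2)))"
        using powr_exp_saddle[OF \<omega> s] unfolding N_def A_def z_def w_def
        by (simp add: norm_mult norm_exp_eq_Re)
      also have "\<dots> \<le> A * exp (- (pi * r\<^sup>2 / 4))"
        using Re_saddle_D[OF \<omega>0 s] A0 by (intro mult_left_mono) (auto simp: power2_eq_square)
      finally have N: "N \<le> A * exp (- (pi * r\<^sup>2 / 4))" .
      have eb: "exp (- (cmod b * r)) \<le> cmod (exp (b * \<omega>))"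
        using abs_Re_le_cmod[of "b * \<omega>"] by (simp add: norm_exp_eq_Re norm_mult r_def)
      have "A * exp (- (pi * r\<^sup>2 / 4)) = A / r * exp (- (cmod b * r)) * (h r / r)"
      proof -
        have "exp (- (pi * r\<^sup>2 / 4)) = exp (- (cmod b * r)) * exp (cmod b * r - pi * r\<^sup>2 / 4)"
          by (simp flip: exp_add)
        then show ?thesis using r1 by (simp add: h_def power2_eq_square)
      qed
      also have "\<dots> \<le> A / r * cmod (exp (b * \<omega>)) * (C / r)"
        using eb C r1 A0 by (intro mult_mono divide_right_mono mult_left_mono) (auto simp: h_def)
      also have "\<dots> = C / r * cmod (saddle_main \<omega>)"
        by (simp add: saddle_main_def A_def r_def w_def norm_mult norm_divide)
      finally have "N \<le> C / r * cmod (saddle_main \<omega>)" using N by linarith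
      then have "N * (1 + 2 * B) \<le> C / r * cmod (saddle_main \<omega>) * (1 + 2 * B)"
        using B_nonneg by (intro mult_right_mono) auto
      then show ?thesis by (simp add: mult_ac)
    qed
    finally show ?thesis by (simp add: z_def r_def)
  qed
  have "(1 + 2 * B) * C \<ge> 0" using B_nonneg C by simp
  then show ?thesis using main by blast
qed

text \<open>Moving the starting point from 0 to \<omega> - |\<omega>|/2 costs a difference of values
  of the primitive, which is the ray estimate; what remains is the integral along the horizontal
  line.\<close>

theorem J_asymp:
  "\<exists>C\<ge>0. \<forall>\<omega>. 0 < Im \<omega> \<longrightarrow> Im \<omega> < Re \<omega> \<longrightarrow> 1 \<le> cmod \<omega> \<longrightarrow> 2 < Re (2 * of_real pi * \<omega>\<^sup>2) \<longrightarrow>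
     cmod (J (2 * of_real pi * \<omega>\<^sup>2) / (saddle_main \<omega> * (exp (b\<^sup>2 / (8 * of_real pi)) / of_real (sqrt 2))) - 1) \<le> C / cmod \<omega>"
proof -
  define g where "g = exp (b\<^sup>2 / (8 * of_real pi)) / of_real (sqrt 2)"
  have g0: "g \<noteq> 0" by (simp add: g_def)
  obtain C1 where C1: "C1 \<ge> 0" "\<And>\<omega>. 0 < Im \<omega> \<Longrightarrow> Im \<omega> < Re \<omega> \<Longrightarrow> 1 \<le> cmod \<omega> \<Longrightarrow> 2 < Re (2 * of_real pi * \<omega>\<^sup>2) \<Longrightarrow>
     cmod ((LBINT t:{0..}. G (2 * of_real pi * \<omega>\<^sup>2) (\<omega> - of_real (cmod \<omega> / 2) + of_real t))
       - saddle_main \<omega> * g) \<le> C1 / cmod \<omega> * cmod (saddle_main \<omega>)"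
    using J_saddle_line unfolding g_def by metis
  obtain C2 where C2: "C2 \<ge> 0" "\<And>\<omega> H. 0 < Im \<omega> \<Longrightarrow> Im \<omega> < Re \<omega> \<Longrightarrow> 1 \<le> cmod \<omega> \<Longrightarrow> 2 < Re (2 * of_real pi * \<omega>\<^sup>2) \<Longrightarrow>
     (\<forall>z\<in>Sec. (H has_field_derivative G (2 * of_real pi * \<omega>\<^sup>2) z) (at z within Sec)) \<Longrightarrow>
     cmod (H (\<omega> - of_real (cmod \<omega> / 2)) - H 0) \<le> C2 / cmod \<omega> * cmod (saddle_main \<omega>)"
    using J_saddle_ray by metis
  have "cmod (J (2 * of_real pi * \<omega>\<^sup>2) / (saddle_main \<omega> * g) - 1) \<le> ((C1 + C2) / cmod g) / cmod \<omega>"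
    if \<omega>: "0 < Im \<omega>" "Im \<omega> < Re \<omega>" "1 \<le> cmod \<omega>" "2 < Re (2 * of_real pi * \<omega>\<^sup>2)" for \<omega>
  proof -
    define w where "w = 2 * of_real pi * \<omega>\<^sup>2"
    define a where "a = \<omega> - of_real (cmod \<omega> / 2)"
    have \<omega>0: "\<omega> \<noteq> 0" using \<omega> by auto
    have a: "a \<in> Sec"
      using \<omega> cmod_le[of \<omega>] by (auto simp: Sec_def a_def)
    obtain H L where H: "\<forall>z\<in>Sec. (H has_field_derivative G w z) (at z within Sec)"
      and L: "\<forall>a\<in>Sec. (LBINT t:{0..}. G w (a + of_real t)) = L - H a"
      using half_line_integral[of w] \<omega>(4) unfolding w_def by blast
    have "J w = L - H 0" using bspec[OF L zero_in_Sec] by (simp add: J_def)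
    moreover have "(LBINT t:{0..}. G w (a + of_real t)) = L - H a" using L a by simp
    ultimately have "J w - saddle_main \<omega> * g = ((LBINT t:{0..}. G w (a + of_real t)) - saddle_main \<omega> * g) + (H a - H 0)"
      by simp
    also have "cmod \<dots> \<le> C1 / cmod \<omega> * cmod (saddle_main \<omega>) + C2 / cmod \<omega> * cmod (saddle_main \<omega>)"
      using C1(2)[OF \<omega>] C2(2)[OF \<omega>, of H] H unfolding w_def a_def by (intro norm_triangle_mono) auto
    finally have le: "cmod (J w - saddle_main \<omega> * g) \<le> (C1 + C2) / cmod \<omega> * cmod (saddle_main \<omega>)"
      by (simp add: add_divide_distrib algebra_simps)
    have "J w / (saddle_main \<omega> * g) - 1 = (J w - saddle_main \<omega> * g) / (saddle_main \<omega> * g)"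
      using saddle_main_nonzero[OF \<omega>0] g0 by (simp add: diff_divide_distrib)
    then have "cmod (J w / (saddle_main \<omega> * g) - 1) \<le> ((C1 + C2) / cmod \<omega> * cmod (saddle_main \<omega>)) / cmod (saddle_main \<omega> * g)"
      by (simp only: norm_divide divide_right_mono[OF le norm_ge_zero])
    also have "\<dots> = ((C1 + C2) / cmod g) / cmod \<omega>"
      using saddle_main_nonzero[OF \<omega>0] by (simp add: norm_mult)
    finally show ?thesis by (simp add: w_def)
  qed
  then show ?thesis
    using C1(1) C2(1) unfolding g_def[symmetric] by (intro exI[of _ "(C1 + C2) / cmod g"]) auto
qed

end

section \<open>Stirling's formula\<close>

interpretation gam: saddle_kernel "\<lambda>z. z" 0 0
  by unfold_locales (auto intro: continuous_on_id)

text \<open>The substitution v = \<pi> t^2 in Euler's integral. It doubles the argument, so for w =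
  2\<pi>\<omega>^2 the saddle point sits at sqrt 2 \<omega>.\<close>

lemma Gamma_eq_J:
  assumes w: "Re w > 1"
  shows "Gamma w = 2 * of_real pi powr w * gam.J (2 * w)"
proof -
  define f where "f v = of_real v powr (w - 1) / of_real (exp v)" for v :: real
  have f_abs: "f absolutely_integrable_on {0..}"
  proof -
    have "f absolutely_integrable_on {0<..}"
      unfolding f_def using w by (intro absolutely_integrable_Gamma_integral') auto
    moreover have "(\<lambda>x. indicat_real {0..} x *\<^sub>R f x) = (\<lambda>x. indicat_real {0<..} x *\<^sub>R f x)"
      by (auto simp: f_def indicator_def)
    ultimately show ?thesis by (simp only: set_integrable_def)
  qed
  have f_lim: "((\<lambda>T. integral {0..T} f) \<longlongrightarrow> Gamma w) at_top"
  proof -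
    have "(f has_integral Gamma w) {0..}"
      unfolding f_def using w by (intro Gamma_integral_complex) auto
    then have "integral {0..} f = Gamma w" by (rule integral_unique)
    moreover have "((\<lambda>T. set_lebesgue_integral lebesgue {0..T} f) \<longlongrightarrow> set_lebesgue_integral lebesgue {0..} f) at_top"
      by (intro tendsto_set_lebesgue_integral_at_top f_abs) auto
    moreover have "set_lebesgue_integral lebesgue {0..T} f = integral {0..T} f" for T
      using f_abs by (intro set_lebesgue_integral_eq_integral) (rule set_integrable_subset, auto)
    moreover have "set_lebesgue_integral lebesgue {0..} f = integral {0..} f"
      using f_abs by (intro set_lebesgue_integral_eq_integral)
    ultimately show ?thesis by simp
  qed
  have "continuous_on {0..} f"
    unfolding f_def continuous_on_eq_continuous_within
  proof
    fix x :: real assume "x \<in> {0..}"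
    show "continuous (at x within {0..}) (\<lambda>v. of_real v powr (w - 1) / of_real (exp v))"
    proof (cases "x = 0")
      case False
      then have "of_real x \<notin> (\<real>\<^sub>\<le>\<^sub>0 :: complex set)" using \<open>x \<in> {0..}\<close> by auto
      then have "isCont (\<lambda>v. of_real v powr (w - 1) / complex_of_real (exp v)) x"
        by (auto intro!: continuous_intros)
      then show ?thesis by (rule continuous_at_imp_continuous_at_within)
    next
      case True
      have "((\<lambda>v. of_real v powr (w - 1)) \<longlongrightarrow> (0::complex)) (at 0 within {0..})"
      proof (rule Lim_null_comparison)
        show "\<forall>\<^sub>F v in at 0 within {0..}. cmod (of_real v powr (w - 1)) \<le> \<bar>v\<bar> powr (Re w - 1) * exp (pi * \<bar>Im w\<bar>)"
          using norm_powr_complex_le[of _ "w - 1"] by (intro always_eventually allI) (metis norm_of_real Re_complex_of_real minus_complex.sel(1,2) one_complex.sel(1,2) diff_zero)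
        have "((\<lambda>v. \<bar>v\<bar> powr (Re w - 1) * exp (pi * \<bar>Im w\<bar>)) \<longlongrightarrow> \<bar>0\<bar> powr (Re w - 1) * exp (pi * \<bar>Im w\<bar>)) (at 0 within {0..})"
          using w by (intro tendsto_intros) (auto intro: always_eventually)
        then show "((\<lambda>v. \<bar>v\<bar> powr (Re w - 1) * exp (pi * \<bar>Im w\<bar>)) \<longlongrightarrow> 0) (at 0 within {0..})"
          by simp
      qed
      then have "((\<lambda>v. of_real v powr (w - 1) / complex_of_real (exp v)) \<longlongrightarrow> 0 / complex_of_real (exp 0)) (at 0 within {0..})"
        by (intro tendsto_intros) auto
      then show ?thesis using True by (simp add: continuous_within)
    qed
  qed
  note f_cont = this
  have G_int: "set_integrable lborel {0..} (\<lambda>t. gam.G (2 * w) (of_real t))"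
    using gam.set_integrable_G[of "2 * w" 0] w by simp
  \<comment> \<open>The substitution is made on compact intervals, with continuity of
    \<open>f\<close> at 0 coming from Re w > 1; both sides then pass to the limit.\<close>
  have sub: "2 * of_real pi powr w * (LBINT t:{0..T}. gam.G (2 * w) (of_real t)) = integral {0..pi * T\<^sup>2} f" if T: "T \<ge> 0" for T
  proof -
    have "((\<lambda>t. (2 * pi * t) *\<^sub>R f (pi * t\<^sup>2)) has_integral (integral {pi * 0\<^sup>2..pi * T\<^sup>2} f)) {0..T}"
    proof (rule has_integral_substitution[of 0 T "\<lambda>t. pi * t\<^sup>2" 0 "pi * T\<^sup>2"])
      show "continuous_on {0..pi * T\<^sup>2} f" by (rule continuous_on_subset[OF f_cont]) auto
      show "(\<lambda>t. pi * t\<^sup>2) ` {0..T} \<subseteq> {0..pi * T\<^sup>2}" by (auto intro: power_mono)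
      show "((\<lambda>t. pi * t\<^sup>2) has_real_derivative 2 * pi * t) (at t within {0..T})" for t
        by (auto intro!: derivative_eq_intros)
    qed (use T in auto)
    moreover have "(2 * pi * t) *\<^sub>R f (pi * t\<^sup>2) = 2 * of_real pi powr w * gam.G (2 * w) (of_real t)" if t: "t \<in> {0..T}" for t
    proof (cases "t = 0")
      case False
      then have t0: "t > 0" using t by auto
      have "of_real (pi * t\<^sup>2) powr (w - 1) = exp ((w - 1) * of_real (ln pi + 2 * ln t))"
      proof -
        have "Ln (of_real (pi * t\<^sup>2)) = of_real (ln pi + 2 * ln t)"
          using t0 by (subst Ln_of_real) (auto simp: ln_mult ln_realpow)
        then show ?thesis using t0 by (simp only: powr_def) simp
      qed
      also have "\<dots> = of_real pi powr (w - 1) * of_real t powr (2 * w - 2)"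
        using t0 by (simp add: powr_def Ln_of_real ring_distribs mult_ac flip: exp_add)
      finally have "of_real (pi * t\<^sup>2) powr (w - 1) = of_real pi powr (w - 1) * of_real t powr (2 * w - 2)" .
      moreover have "of_real pi powr (w - 1) * of_real pi = of_real pi powr w"
        by (simp add: powr_diff)
      ultimately show ?thesis
        by (simp add: f_def gam.G_def scaleR_conv_of_real exp_minus divide_inverse mult_ac flip: exp_of_real)
    qed (simp add: f_def)
    ultimately have "((\<lambda>t. 2 * of_real pi powr w * gam.G (2 * w) (of_real t)) has_integral integral {0..pi * T\<^sup>2} f) {0..T}"
      by (metis (no_types, lifting) has_integral_cong mult_zero_right zero_power2)
    then have "integral {0..T} (\<lambda>t. 2 * of_real pi powr w * gam.G (2 * w) (of_real t)) = integral {0..pi * T\<^sup>2} f"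
      by (rule integral_unique)
    moreover have "set_integrable lborel {0..T} (\<lambda>t. gam.G (2 * w) (of_real t))"
      by (rule set_integrable_subset[OF G_int]) auto
    ultimately show ?thesis
      by (simp only: set_borel_integral_eq_integral(2) integral_mult_right)
  qed
  have "((\<lambda>T. 2 * of_real pi powr w * (LBINT t:{0..T}. gam.G (2 * w) (of_real t))) \<longlongrightarrow> 2 * of_real pi powr w * gam.J (2 * w)) at_top"
    unfolding gam.J_def
    by (intro tendsto_mult_left tendsto_set_lebesgue_integral_at_top G_int) auto
  moreover have "\<forall>\<^sub>F T in at_top. 2 * of_real pi powr w * (LBINT t:{0..T}. gam.G (2 * w) (of_real t)) = integral {0..pi * T\<^sup>2} f"
    using sub by (intro eventually_at_top_linorderI[of 0]) auto
  ultimately have "((\<lambda>T. integral {0..pi * T\<^sup>2} f) \<longlongrightarrow> 2 * of_real pi powr w * gam.J (2 * w)) at_top"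
    by (rule Lim_transform_eventually)
  moreover have "filterlim (\<lambda>T::real. pi * T\<^sup>2) at_top at_top"
    by real_asymp
  then have "((\<lambda>T. integral {0..pi * T\<^sup>2} f) \<longlongrightarrow> Gamma w) at_top"
    by (rule filterlim_compose[OF f_lim])
  ultimately show ?thesis
    using tendsto_unique[OF trivial_limit_at_top_linorder] by blast
qed

text \<open>For w = 2\<pi>\<omega>^2 in the sector 0 < Im \<omega> < Re \<omega> this is the
  classical sqrt(2\<pi>) w^(w-1/2) e^(-w), the square root of w being sqrt(2\<pi>) \<omega>. The
  form given here is the one that \<open>J_asymp\<close> produces.\<close>

definition Stirling_main :: "complex \<Rightarrow> complex" where
  "Stirling_main \<omega> = 2 * of_real pi powr (2 * of_real pi * \<omega>\<^sup>2) * gam.saddle_main (of_real (sqrt 2) * \<omega>) / of_real (sqrt 2)"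

text \<open>The reciprocal is what \<chi> contributes to f. Being entire, it is bounded on compact
  sets without any lower bound for Gamma.\<close>

lemma rGamma_asymp:
  "\<exists>C\<ge>0. \<forall>\<omega>. 0 < Im \<omega> \<longrightarrow> Im \<omega> < Re \<omega> \<longrightarrow> 1 \<le> cmod \<omega> \<longrightarrow> 2 < Re (2 * of_real pi * \<omega>\<^sup>2) \<longrightarrow>
     cmod (Stirling_main \<omega> * rGamma (2 * of_real pi * \<omega>\<^sup>2) - 1) \<le> C / cmod \<omega>"
proof -
  obtain C where C: "C \<ge> 0" "\<And>\<omega>. 0 < Im \<omega> \<Longrightarrow> Im \<omega> < Re \<omega> \<Longrightarrow> 1 \<le> cmod \<omega> \<Longrightarrow> 2 < Re (2 * of_real pi * \<omega>\<^sup>2) \<Longrightarrow>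
     cmod (gam.J (2 * of_real pi * \<omega>\<^sup>2) / (gam.saddle_main \<omega> * (exp (0\<^sup>2 / (8 * of_real pi)) / of_real (sqrt 2))) - 1) \<le> C / cmod \<omega>"
    using gam.J_asymp by metis
  \<comment> \<open>The saddle point estimate bounds \<open>1/\<Gamma>(w)\<close> only for \<open>|\<omega>| > R\<close>; compactness covers the rest.\<close>
  define R where "R = 2 * C + 1"
  \<comment> \<open>The strict inequalities are relaxed to obtain a closed set; 1 <= |\<omega>|
    excludes the corner 0, so Re \<omega> > 0 persists and the function is still continuous on
    \<open>X\<close>.\<close>
  define X where "X = {\<omega>. 0 \<le> Im \<omega> \<and> Im \<omega> \<le> Re \<omega> \<and> 1 \<le> cmod \<omega> \<and> cmod \<omega> \<le> R}"
  have "compact X"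
  proof -
    have "closed X"
      unfolding X_def by (intro closed_Collect_conj closed_Collect_le continuous_intros)
    moreover have "bounded X"
      unfolding X_def by (auto simp: bounded_iff)
    ultimately show ?thesis by (simp add: compact_eq_bounded_closed)
  qed
  have pos: "0 < Re \<omega>" if "\<omega> \<in> X" for \<omega>
  proof (rule ccontr)
    assume "\<not> 0 < Re \<omega>"
    then have "\<omega> = 0" using that by (auto simp: X_def complex_eq_iff)
    then show False using that by (simp add: X_def)
  qed
  have nonpos: "\<omega> \<notin> \<real>\<^sub>\<le>\<^sub>0" "of_real (sqrt 2) * \<omega> \<notin> \<real>\<^sub>\<le>\<^sub>0" "\<omega> \<noteq> 0" if "0 < Re \<omega>" for \<omega>
    using that by (auto simp: complex_nonpos_Reals_iff mult_le_0_iff)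
  have "(\<lambda>\<omega>. Stirling_main \<omega> * rGamma (2 * of_real pi * \<omega>\<^sup>2)) holomorphic_on {\<omega>. 0 < Re \<omega>}"
    unfolding Stirling_main_def gam.saddle_main_def
    by (intro holomorphic_intros) (auto simp: nonpos)
  then have "continuous_on X (\<lambda>\<omega>. Stirling_main \<omega> * rGamma (2 * of_real pi * \<omega>\<^sup>2))"
    using pos by (intro continuous_on_subset[OF holomorphic_on_imp_continuous_on]) auto
  then have "compact ((\<lambda>\<omega>. Stirling_main \<omega> * rGamma (2 * of_real pi * \<omega>\<^sup>2)) ` X)"
    using \<open>compact X\<close> by (intro compact_continuous_image)
  then have "bounded ((\<lambda>\<omega>. Stirling_main \<omega> * rGamma (2 * of_real pi * \<omega>\<^sup>2)) ` X)"
    by (rule compact_imp_bounded)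
  then obtain N where N: "\<And>\<omega>. \<omega> \<in> X \<Longrightarrow> cmod (Stirling_main \<omega> * rGamma (2 * of_real pi * \<omega>\<^sup>2)) \<le> N"
    unfolding bounded_iff by blast
  have main: "cmod (Stirling_main \<omega> * rGamma (2 * of_real pi * \<omega>\<^sup>2) - 1) \<le> (2 * C + (\<bar>N\<bar> + 1) * R) / cmod \<omega>"
    if \<omega>: "0 < Im \<omega>" "Im \<omega> < Re \<omega>" "1 \<le> cmod \<omega>" "2 < Re (2 * of_real pi * \<omega>\<^sup>2)" for \<omega>
  proof (cases "cmod \<omega> \<le> R")
    case True
    then have "\<omega> \<in> X" using \<omega> by (simp add: X_def)
    then have "cmod (Stirling_main \<omega> * rGamma (2 * of_real pi * \<omega>\<^sup>2) - 1) \<le> \<bar>N\<bar> + 1"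
      using N[of \<omega>] norm_triangle_ineq4[of "Stirling_main \<omega> * rGamma (2 * of_real pi * \<omega>\<^sup>2)" 1] by simp
    also have "\<dots> \<le> (\<bar>N\<bar> + 1) * (R / cmod \<omega>)"
    proof -
      have "0 < cmod \<omega>" using \<omega>(3) by linarith
      then have "1 \<le> R / cmod \<omega>" using True by (simp add: le_divide_eq_1_pos)
      then show ?thesis using mult_left_mono[of 1 "R / cmod \<omega>" "\<bar>N\<bar> + 1"] by simp
    qed
    also have "\<dots> \<le> (2 * C + (\<bar>N\<bar> + 1) * R) / cmod \<omega>"
      using C(1) by (simp add: divide_right_mono)
    finally show ?thesis .
  next
    case False
    define w where "w = 2 * of_real pi * \<omega>\<^sup>2"
    define \<omega>' where "\<omega>' = of_real (sqrt 2) * \<omega>"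
    have \<omega>'2: "2 * of_real pi * \<omega>'\<^sup>2 = 2 * w"
    proof -
      have "(of_real (sqrt 2))\<^sup>2 = (2 :: complex)"
        by (metis of_real_power of_real_numeral real_sqrt_pow2 zero_le_numeral)
      then show ?thesis by (simp add: \<omega>'_def w_def power_mult_distrib)
    qed
    have n: "cmod \<omega>' = sqrt 2 * cmod \<omega>" by (simp add: \<omega>'_def norm_mult)
    have s2: "1 \<le> sqrt 2" by simp
    have nge: "cmod \<omega> \<le> cmod \<omega>'" unfolding n using mult_right_mono[OF s2 norm_ge_zero[of \<omega>]] by simp
    define \<delta> where "\<delta> = gam.J (2 * w) / (gam.saddle_main \<omega>' / of_real (sqrt 2)) - 1"
    have "cmod (gam.J (2 * of_real pi * \<omega>'\<^sup>2) / (gam.saddle_main \<omega>' * (exp (0\<^sup>2 / (8 * of_real pi)) / of_real (sqrt 2))) - 1) \<le> C / cmod \<omega>'"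
    proof (rule C(2))
      show "0 < Im \<omega>'" "Im \<omega>' < Re \<omega>'" using \<omega> by (simp_all add: \<omega>'_def)
      show "1 \<le> cmod \<omega>'" using nge \<omega>(3) by linarith
      show "2 < Re (2 * of_real pi * \<omega>'\<^sup>2)" using \<omega>(4) unfolding \<omega>'2 w_def by simp
    qed
    then have "cmod \<delta> \<le> C / cmod \<omega>'" by (simp add: \<delta>_def \<omega>'2)
    also have "\<dots> \<le> C / cmod \<omega>"
      using nge \<omega>(3) C(1) by (intro divide_left_mono) (auto intro!: mult_pos_pos)
    finally have \<delta>: "cmod \<delta> \<le> C / cmod \<omega>" .
    \<comment> \<open>This is what R = 2C + 1 was chosen for; it keeps 1 + \<delta> away from
      0.\<close>
    also have "C / cmod \<omega> \<le> 1 / 2"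
      using False \<omega>(3) C(1) unfolding R_def by (simp add: divide_simps)
    finally have \<delta>2: "cmod \<delta> \<le> 1 / 2" .
    then have "1 - cmod \<delta> \<le> cmod (1 + \<delta>)"
      using norm_diff_ineq[of 1 \<delta>] by simp
    then have d: "cmod (1 + \<delta>) \<ge> 1 / 2" using \<delta>2 by linarith
    have m0: "gam.saddle_main \<omega>' \<noteq> 0"
      using \<omega> by (intro gam.saddle_main_nonzero) (auto simp: \<omega>'_def)
    have "Gamma w = 2 * of_real pi powr w * gam.J (2 * w)"
      using \<omega>(4) by (intro Gamma_eq_J) (simp add: w_def)
    also have "\<dots> = Stirling_main \<omega> * (1 + \<delta>)"
      using m0 by (simp add: Stirling_main_def \<delta>_def w_def[symmetric] \<omega>'_def[symmetric])
    finally have "Gamma w = Stirling_main \<omega> * (1 + \<delta>)" .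
    moreover have "Stirling_main \<omega> \<noteq> 0"
      using m0 by (simp add: Stirling_main_def \<omega>'_def[symmetric])
    ultimately have "Stirling_main \<omega> * rGamma w - 1 = 1 / (1 + \<delta>) - 1"
      by (simp only: rGamma_inverse_Gamma inverse_mult_distrib divide_inverse mult.assoc[symmetric]) simp
    also have "\<dots> = - \<delta> / (1 + \<delta>)"
    proof -
      have "1 + \<delta> \<noteq> 0" using d by auto
      then show ?thesis by (simp add: divide_simps)
    qed
    finally have "cmod (Stirling_main \<omega> * rGamma w - 1) = cmod \<delta> / cmod (1 + \<delta>)"
      by (simp add: norm_divide)
    also have "\<dots> \<le> (C / cmod \<omega>) / (1 / 2)"
      using \<delta> d C(1) by (intro frac_le) auto
    also have "\<dots> \<le> (2 * C + (\<bar>N\<bar> + 1) * R) / cmod \<omega>"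
      using C(1) by (simp add: R_def divide_right_mono mult.commute)
    finally show ?thesis by (simp add: w_def)
  qed
  show ?thesis
    using C(1) by (intro exI[of _ "2 * C + (\<bar>N\<bar> + 1) * R"] conjI allI impI main) (auto simp: R_def)
qed

section \<open>Riemann's auxiliary function as a half-line integral\<close>

abbreviation rot :: complex where "rot \<equiv> cis (pi / 4)"

lemma rot_sq: "rot\<^sup>2 = \<i>"
  by (simp add: power2_eq_square cis_mult)

lemma Im_rot_mult: "Im (rot * z) = sqrt 2 / 2 * (Re z + Im z)"
  by (simp add: cos_45 sin_45 algebra_simps)

text \<open>With x = \<open>rot * z\<close>, \<open>Raux_kernel z / z\<close> is -1/(e^(\<pi>ix) -
  e^(-\<pi>ix)). It is written through e^(2\<pi>ix), which has modulus below 1 in the half plane, to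
  display the approximation e^(\<pi>ix). The value at 0 is the limit.\<close>

definition Raux_kernel :: "complex \<Rightarrow> complex" where
  "Raux_kernel z =
     (if z = 0 then - 1 / (2 * of_real pi * \<i> * rot)
      else z * exp (of_real pi * \<i> * rot * z) / (1 - exp (2 * of_real pi * \<i> * rot * z)))"

lemma norm_exp_rot: "cmod (exp (2 * of_real pi * \<i> * rot * z)) = exp (- (sqrt 2 * pi * (Re z + Im z)))"
proof -
  have "Re (2 * of_real pi * \<i> * rot * z) = - (2 * pi * Im (rot * z))"
    by (simp add: algebra_simps)
  then show ?thesis unfolding norm_exp_eq_Re Im_rot_mult by simp
qed

text \<open>Modulus 1 forces z onto the boundary line, where \<open>rot * z\<close> is real and
  would have to be an integer; |z| < 1 leaves only 0.\<close>

lemma exp_rot_neq_1: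
  assumes "z \<in> Sec" "z \<noteq> 0"
  shows "exp (2 * of_real pi * \<i> * rot * z) \<noteq> 1"
proof
  assume eq: "exp (2 * of_real pi * \<i> * rot * z) = 1"
  then have "exp (- (sqrt 2 * pi * (Re z + Im z))) = 1"
    using norm_exp_rot[of z] by simp
  then have V: "Re z + Im z = 0" by simp
  then have z1: "cmod z < 1" using assms by (auto simp: Sec_def)
  obtain n :: int where n: "Im (2 * of_real pi * \<i> * rot * z) = of_int (2 * n) * pi"
    using eq unfolding exp_eq_1 by blast
  have "Im (2 * of_real pi * \<i> * rot * z) = 2 * pi * Re (rot * z)"
    by (simp add: algebra_simps)
  with n have re: "Re (rot * z) = of_int n" by simp
  have "\<bar>Re (rot * z)\<bar> < 1"
    using abs_Re_le_cmod[of "rot * z"] z1 by (simp add: norm_mult)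
  then have "n = 0" using re by simp
  then have "rot * z = 0"
    using re V Im_rot_mult[of z] by (simp add: complex_eq_iff)
  then show False using assms by simp
qed

text \<open>With q = e^(2\<pi>i \<open>rot\<close> z) the relative error of the kernel is q/(1-q),
  at most 1/(e^x - 1) <= 1/x for x = sqrt 2 \<pi> (Re z + Im z). Hence B = 1 is enough.\<close>

interpretation raux: saddle_kernel Raux_kernel "of_real pi * \<i> * rot" 1
proof
  have re: "Re (of_real pi * \<i> * rot * z) = - (pi * (sqrt 2 / 2) * (Re z + Im z))" for z
  proof -
    have "Re (of_real pi * \<i> * rot * z) = - (pi * Im (rot * z))"
      by (simp add: algebra_simps)
    then show ?thesis unfolding Im_rot_mult by simp
  qed
  show "Re (of_real pi * \<i> * rot * z) \<le> 0" if "Re z + Im z \<ge> 0" for z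
    using that unfolding re by simp
  show "continuous_on Sec Raux_kernel"
    unfolding continuous_on_eq_continuous_within
  proof
    fix z assume z: "z \<in> Sec"
    define c where "c = 2 * of_real pi * \<i> * rot"
    have c0: "c \<noteq> 0" by (simp add: c_def)
    show "continuous (at z within Sec) Raux_kernel"
    proof (cases "z = 0")
      case True
      have "((\<lambda>z. exp (c * z)) has_field_derivative c) (at 0)"
        by (auto intro!: derivative_eq_intros)
      then have "((\<lambda>z. (exp (c * z) - 1) / z) \<longlongrightarrow> c) (at 0)"
        by (simp add: has_field_derivative_iff)
      moreover have "((\<lambda>z. - exp (of_real pi * \<i> * rot * z)) \<longlongrightarrow> - exp (of_real pi * \<i> * rot * 0)) (at 0)"
        by (intro tendsto_intros)
      ultimately have "((\<lambda>z. - exp (of_real pi * \<i> * rot * z) / ((exp (c * z) - 1) / z)) \<longlongrightarrow> - exp (of_real pi * \<i> * rot * 0) / c) (at 0)"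
        using c0 by (intro tendsto_divide)
      moreover have "- exp (of_real pi * \<i> * rot * z) / ((exp (c * z) - 1) / z) = Raux_kernel z" if "z \<noteq> 0" for z
        using that by (simp add: Raux_kernel_def c_def[symmetric]) (simp add: divide_simps, simp add: algebra_simps)
      then have "\<forall>\<^sub>F z in at 0. - exp (of_real pi * \<i> * rot * z) / ((exp (c * z) - 1) / z) = Raux_kernel z"
        by (auto simp: eventually_at_filter)
      ultimately have "(Raux_kernel \<longlongrightarrow> - exp (of_real pi * \<i> * rot * 0) / c) (at 0)"
        by (rule Lim_transform_eventually)
      then have "isCont Raux_kernel 0"
        by (simp add: isCont_def Raux_kernel_def c_def)
      then show ?thesis using True by (auto intro: continuous_at_imp_continuous_at_within)
    next
      case False
      have "isCont (\<lambda>z. z * exp (of_real pi * \<i> * rot * z) / (1 - exp (2 * of_real pi * \<i> * rot * z))) z"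
        using exp_rot_neq_1[OF z False] by (intro continuous_intros) auto
      moreover have "\<forall>\<^sub>F u in nhds z. Raux_kernel u = u * exp (of_real pi * \<i> * rot * u) / (1 - exp (2 * of_real pi * \<i> * rot * u))"
      proof -
        have "\<forall>\<^sub>F u in nhds z. u \<in> - {0}"
          using False by (intro eventually_nhds_in_open) auto
        then show ?thesis by (rule eventually_mono) (simp add: Raux_kernel_def)
      qed
      ultimately have "isCont Raux_kernel z"
        by (simp add: isCont_cong)
      then show ?thesis by (rule continuous_at_imp_continuous_at_within)
    qed
  qed
  show "Raux_kernel holomorphic_on {z. Re z + Im z > 0}"
  proof -
    have "1 - exp (2 * of_real pi * \<i> * rot * z) \<noteq> 0" if "z \<in> {z. Re z + Im z > 0}" for z
    proof -
      have "z \<in> Sec" "z \<noteq> 0" using that by (auto simp: Sec_def)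
      then show ?thesis using exp_rot_neq_1[of z] by (simp only: right_minus_eq) metis
    qed
    then have "(\<lambda>z. z * exp (of_real pi * \<i> * rot * z) / (1 - exp (2 * of_real pi * \<i> * rot * z))) holomorphic_on {z. Re z + Im z > 0}"
      by (intro holomorphic_intros)
    then show ?thesis
      by (rule holomorphic_transform) (auto simp: Raux_kernel_def)
  qed
  show "cmod (Raux_kernel z / z * exp (- (of_real pi * \<i> * rot * z)) - 1) \<le> 1 / (Re z + Im z)" if V: "Re z + Im z > 0" for z
  proof -
    define q where "q = exp (2 * of_real pi * \<i> * rot * z)"
    define x where "x = sqrt 2 * pi * (Re z + Im z)"
    have z0: "z \<noteq> 0" using V by auto
    have z: "z \<in> Sec" using V by (simp add: Sec_def)
    have q1: "q \<noteq> 1" using exp_rot_neq_1[OF z z0] by (simp add: q_def)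
    have nq: "cmod q = exp (- x)" unfolding q_def x_def by (rule norm_exp_rot)
    have x0: "x > 0" using V by (simp add: x_def)
    have "Raux_kernel z / z * exp (- (of_real pi * \<i> * rot * z)) = 1 / (1 - q)"
      using z0 by (simp add: Raux_kernel_def q_def[symmetric] exp_minus)
    then have "Raux_kernel z / z * exp (- (of_real pi * \<i> * rot * z)) - 1 = 1 / (1 - q) - 1"
      by simp
    also have "\<dots> = q / (1 - q)"
      using q1 by (simp add: divide_simps)
    finally have "cmod (Raux_kernel z / z * exp (- (of_real pi * \<i> * rot * z)) - 1) = exp (- x) / cmod (1 - q)"
      by (simp add: norm_divide nq)
    also have "\<dots> \<le> exp (- x) / (1 - exp (- x))"
      using x0 norm_triangle_ineq2[of 1 q] nq q1 by (intro divide_left_mono) (auto intro!: mult_pos_pos)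
    also have "\<dots> = 1 / (exp x - 1)"
      using x0 by (simp add: exp_minus divide_simps)
    also have "\<dots> \<le> 1 / x"
    proof -
      have "x \<le> exp x - 1" using exp_ge_add_one_self[of x] by linarith
      then show ?thesis using x0 by (intro divide_left_mono) (auto intro!: mult_pos_pos)
    qed
    also have "\<dots> \<le> 1 / (Re z + Im z)"
    proof -
      have "1 \<le> sqrt 2 * pi" using pi_gt3 mult_mono[of 1 "sqrt 2" 1 pi] by simp
      then have "Re z + Im z \<le> x"
        using V mult_right_mono[of 1 "sqrt 2 * pi" "Re z + Im z"] by (simp add: x_def)
      then show ?thesis using V x0 by (intro divide_left_mono) auto
    qed
    finally show ?thesis .
  qed
qed auto

lemma raux_G_eq:
  assumes "z \<noteq> 0"
  shows "raux.G w z = - (z powr (w - 1) * exp (- of_real pi * z\<^sup>2) /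
          (exp (of_real pi * \<i> * (rot * z)) - exp (- (of_real pi * \<i> * (rot * z)))))"
proof -
  define y where "y = of_real pi * \<i> * rot * z"
  have y2: "exp (2 * of_real pi * \<i> * rot * z) = exp y * exp y"
    unfolding y_def exp_add[symmetric] by (rule arg_cong[of _ _ exp]) (simp add: algebra_simps)
  have "exp y / (1 - exp y * exp y) = 1 / (exp (- y) - exp y)"
  proof -
    have "1 - exp y * exp y = exp y * (exp (- y) - exp y)"
      by (simp add: algebra_simps flip: exp_add)
    then show ?thesis by simp
  qed
  also have "\<dots> = - (1 / (exp y - exp (- y)))"
    by (simp add: minus_divide_right)
  finally have K': "exp y / (1 - exp y * exp y) = - (1 / (exp y - exp (- y)))" .
  have "Raux_kernel z = z * (exp y / (1 - exp y * exp y))"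
    using assms by (simp add: Raux_kernel_def y_def[symmetric] y2)
  then have K: "Raux_kernel z = - (z / (exp y - exp (- y)))"
    unfolding K' by simp
  have "z powr (w - 1) = z powr (w - 2 + 1)" by simp
  also have "\<dots> = z powr (w - 2) * z"
    using assms by (simp only: powr_add powr_to_1)
  finally show ?thesis
    using K by (simp add: raux.G_def y_def mult_ac)
qed

text \<open>Passing from z in the lower right quadrant to -z raises the argument by \<pi>, so
  z^(w-1) acquires the factor -e^(\<pi>iw); the denominator is odd and cancels the sign.\<close>

lemma raux_G_minus:
  assumes "z \<noteq> 0" "Re z \<ge> 0" "Im z < 0"
  shows "exp (- (\<i> * of_real pi * w)) * raux.G w (- z) = raux.G w z"
proof -
  have "Ln (- z) = Ln z + \<i> * of_real pi"
    using assms by (simp add: Ln_minus)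
  then have "(- z) powr (w - 1) = exp ((w - 1) * Ln z + \<i> * of_real pi * w - \<i> * of_real pi)"
    using assms by (simp add: powr_def algebra_simps)
  also have "\<dots> = - (exp (\<i> * of_real pi * w) * z powr (w - 1))"
    using assms by (simp add: powr_def exp_add exp_diff)
  finally have p: "(- z) powr (w - 1) = - (exp (\<i> * of_real pi * w) * z powr (w - 1))" .
  have "- z \<noteq> 0" using assms by simp
  from raux_G_eq[OF this, of w]
  have "raux.G w (- z) = - (- (exp (\<i> * of_real pi * w) * z powr (w - 1)) * exp (- of_real pi * z\<^sup>2) /
     (exp (- (of_real pi * \<i> * (rot * z))) - exp (of_real pi * \<i> * (rot * z))))"
    unfolding p by simp
  also have "\<dots> = exp (\<i> * of_real pi * w) * (z powr (w - 1) * exp (- of_real pi * z\<^sup>2) /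
     (exp (- (of_real pi * \<i> * (rot * z))) - exp (of_real pi * \<i> * (rot * z))))"
    by simp
  also have "\<dots> = exp (\<i> * of_real pi * w) * raux.G w z"
    unfolding raux_G_eq[OF assms(1)] by (metis minus_diff_eq minus_divide_right)
  finally show ?thesis
    by (simp add: mult.assoc[symmetric] exp_minus)
qed

lemma rot_eq_exp: "rot = exp (\<i> * of_real pi / 4)"
  by (simp add: cis_conv_exp)

text \<open>Writing x as \<open>rot * z\<close> for t >= 0 and as \<open>- (rot * z)\<close> for t <
  0 turns the two halves into horizontal half lines from a = c e^(-\<pi>i/4) and from -a. Both
  points lie on the boundary segment of \<open>Sec\<close> because 0 < c < 1. The halves contribute
  L - H a and \<epsilon> (L - H (-a)) up to a common factor, and the reflection z to -z removes the
  dependence on c.\<close>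

lemma Riemann_aux_eq_J:
  assumes c: "0 < c" "c < 1" and w: "2 < Re w"
  shows "Riemann_aux c (1 - w) = exp (\<i> * of_real pi * w / 4) * (1 + exp (- (\<i> * of_real pi * w))) * raux.J w"
proof -
  define a where "a = of_real c * cis (- pi / 4)"
  define \<epsilon> where "\<epsilon> = exp (- (\<i> * of_real pi * w))"
  define \<alpha> where "\<alpha> = exp (\<i> * of_real pi * w / 4)"
  define F where "F t = (let x = of_real c + of_real t * rot
           in x powr (- (1 - w)) * exp (of_real pi * \<i> * x\<^sup>2)
                / (exp (of_real pi * \<i> * x) - exp (- (of_real pi * \<i> * x))) * rot)" for t :: real
  have rot_a: "rot * a = of_real c" by (simp add: a_def cis_mult mult.left_commute)
  have a_ReIm: "Re a = c * (sqrt 2 / 2)" "Im a = - (c * (sqrt 2 / 2))"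
    by (simp_all add: a_def cos_45 sin_45)
  have na: "cmod a = c" using c by (simp add: a_def norm_mult)
  have a: "a \<in> Sec" "- a \<in> Sec" using c na by (auto simp: Sec_def a_ReIm)
  obtain H L where H: "\<forall>z\<in>Sec. (H has_field_derivative raux.G w z) (at z within Sec)"
    and L: "\<forall>a\<in>Sec. (LBINT t:{0..}. raux.G w (a + of_real t)) = L - H a"
    using raux.half_line_integral[OF w] by blast
  have J: "raux.J w = L - H 0"
    using bspec[OF L zero_in_Sec] by (simp add: raux.J_def)
  \<comment> \<open>The segments from \<open>a\<close> and from \<open>-a\<close> to the origin contribute opposite amounts.\<close>
  have sym: "H a + \<epsilon> * H (- a) = H 0 + \<epsilon> * H 0"
  proof -
    define \<phi> where "\<phi> x = H (of_real x * a) + \<epsilon> * H (of_real x * (- a))" for x :: real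
    have Sec_x: "of_real x * a \<in> Sec" "of_real x * (- a) \<in> Sec" if "x \<in> {0..1}" for x :: real
    proof -
      have "\<bar>x\<bar> * c \<le> 1 * c" using that c by (intro mult_right_mono) auto
      then have "\<bar>x\<bar> * c < 1" using c by linarith
      then have "cmod (of_real x * a) < 1" by (simp add: norm_mult na)
      then show "of_real x * a \<in> Sec" "of_real x * (- a) \<in> Sec"
        by (auto simp: Sec_def a_ReIm)
    qed
    have chain: "((\<lambda>x. H (of_real x * v)) has_vector_derivative (v * raux.G w (of_real x * v))) (at x within {0..1})"
      if v: "\<And>x. x \<in> {0..1} \<Longrightarrow> of_real x * v \<in> Sec" and x: "x \<in> {0..1}" for v and x :: real
    proof -
      have "((\<lambda>x. of_real x * v) has_vector_derivative v) (at x within {0..1})"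
        by (auto intro!: derivative_eq_intros)
      moreover have "(H has_field_derivative raux.G w (of_real x * v)) (at (of_real x * v) within (\<lambda>x. of_real x * v) ` {0..1})"
        by (rule has_field_derivative_subset[of _ _ _ Sec]) (use H v x in auto)
      ultimately show ?thesis
        using field_vector_diff_chain_within[of "\<lambda>x. of_real x * v" v x "{0..1}" H "raux.G w (of_real x * v)"]
        by (simp add: o_def)
    qed
    have "(\<phi> has_vector_derivative 0) (at x within {0..1})" if x: "x \<in> {0..1}" for x
    proof -
      have "(\<phi> has_vector_derivative (a * raux.G w (of_real x * a) + \<epsilon> * (- a * raux.G w (of_real x * (- a))))) (at x within {0..1})"
        unfolding \<phi>_def
        by (intro has_vector_derivative_add has_vector_derivative_mult_right chain Sec_x x)
      moreover have "\<epsilon> * raux.G w (of_real x * (- a)) = raux.G w (of_real x * a)"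
      proof (cases "x = 0")
        case False
        have "a \<noteq> 0" using na c by auto
        then have "exp (- (\<i> * of_real pi * w)) * raux.G w (- (of_real x * a)) = raux.G w (of_real x * a)"
          using False x c by (intro raux_G_minus) (simp_all add: a_ReIm)
        then show ?thesis by (simp add: \<epsilon>_def)
      qed simp
      ultimately show ?thesis
        by (metis (no_types, lifting) add.right_inverse mult.left_commute mult_minus_left mult_minus_right)
    qed
    then obtain k where "\<And>x. x \<in> {0..1} \<Longrightarrow> \<phi> x = k"
      by (rule has_vector_derivative_zero_constant[rotated]) auto
    from this[of 0] this[of 1] have "\<phi> 1 = \<phi> 0" by simp
    then show ?thesis by (simp add: \<phi>_def)
  qed
  have sq: "(of_real c + of_real t * rot)\<^sup>2 = \<i> * (a + of_real t)\<^sup>2" for t :: real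
  proof -
    have "of_real c + of_real t * rot = rot * (a + of_real t)"
      by (simp add: ring_distribs mult.commute[of rot] flip: rot_a)
    then show ?thesis by (simp add: power_mult_distrib rot_sq)
  qed
  have F_pos: "F t = - \<alpha> * raux.G w (a + of_real t)" if t: "t \<ge> 0" for t
  proof -
    define z where "z = a + of_real t"
    have x: "of_real c + of_real t * rot = rot * z"
      by (simp add: z_def ring_distribs mult.commute[of rot] flip: rot_a)
    have z: "Re z > 0" "Im z < 0" using c t by (auto simp: z_def a_ReIm intro: add_pos_nonneg)
    then have z0: "z \<noteq> 0" by auto
    have "Ln (rot * z) = Ln rot + Ln z"
    proof (intro Ln_times_simple)
      show "- pi < Im (Ln rot) + Im (Ln z)" "Im (Ln rot) + Im (Ln z) \<le> pi"
        using Re_Ln_pos_lt[OF z0] z by (auto simp: rot_eq_exp Ln_exp abs_if split: if_splits)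
    qed (use z0 in auto)
    then have pw: "(rot * z) powr (w - 1) = exp ((w - 1) * (\<i> * of_real pi / 4)) * z powr (w - 1)"
      using z0 by (simp add: powr_def rot_eq_exp Ln_exp ring_distribs exp_add)
    have "exp ((w - 1) * (\<i> * of_real pi / 4)) * rot = \<alpha>"
      unfolding rot_eq_exp exp_add[symmetric] \<alpha>_def
      by (rule arg_cong[of _ _ exp]) (simp add: field_simps)
    then have e: "exp ((w - 1) * (\<i> * of_real pi / 4)) * rot = \<alpha>" .
    define D where "D = exp (of_real pi * \<i> * (rot * z)) - exp (- (of_real pi * \<i> * (rot * z)))"
    have "F t = (rot * z) powr (w - 1) * exp (of_real pi * \<i> * (\<i> * z\<^sup>2)) / D * rot"
      unfolding F_def Let_def sq unfolding x z_def[symmetric] D_def by simp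
    also have "of_real pi * \<i> * (\<i> * z\<^sup>2) = - of_real pi * z\<^sup>2"
      by (simp add: mult.assoc)
    also have "(rot * z) powr (w - 1) * exp (- of_real pi * z\<^sup>2) / D * rot =
        exp ((w - 1) * (\<i> * of_real pi / 4)) * rot * (z powr (w - 1) * exp (- of_real pi * z\<^sup>2) / D)"
      unfolding pw by (simp only: divide_inverse mult_ac)
    finally have "F t = \<alpha> * (z powr (w - 1) * exp (- of_real pi * z\<^sup>2) / D)"
      unfolding e .
    then show ?thesis
      unfolding raux_G_eq[OF z0] z_def[symmetric] D_def by simp
  qed
  have F_neg: "F (- t) = - (\<alpha> * \<epsilon>) * raux.G w (- a + of_real t)" if t: "t > 0" for t
  proof -
    define z where "z = - a + of_real t"
    have x: "of_real c + of_real (- t) * rot = - (rot * z)"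
      by (simp add: z_def ring_distribs mult.commute[of rot] flip: rot_a)
    have z: "Im z > 0" using c by (auto simp: z_def a_ReIm)
    have z0: "z \<noteq> 0" using z by auto
    have x_exp: "- (rot * z) = exp (Ln z - 3 * \<i> * of_real pi / 4)"
    proof -
      have "exp (Ln z - 3 * \<i> * of_real pi / 4) = exp (Ln z + \<i> * of_real pi / 4 - \<i> * of_real pi)"
        by (rule arg_cong[of _ _ exp]) (simp add: field_simps)
      also have "\<dots> = - (rot * z)"
        unfolding exp_add exp_diff using z0 by (simp add: rot_eq_exp mult.commute)
      finally show ?thesis by simp
    qed
    \<comment> \<open>Since z is in the upper half plane, arg z - 3\<pi>/4 lies between -3\<pi>/4
      and \<pi>/4, so the principal branch requires -3\<pi>/4 and not +5\<pi>/4. This choice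
      produces the factor \<epsilon>.\<close>
    have "Ln (- (rot * z)) = Ln z - 3 * \<i> * of_real pi / 4"
      unfolding x_exp
    proof (rule Ln_exp)
      have "0 < Im (Ln z)" "Im (Ln z) < pi" using z z0 Im_Ln_pos_lt_imp[of z] Im_Ln_pos_lt[OF z0] by auto
      then show "- pi < Im (Ln z - 3 * \<i> * of_real pi / 4)" "Im (Ln z - 3 * \<i> * of_real pi / 4) \<le> pi"
        using pi_gt_zero by (simp_all add: field_simps)
    qed
    then have "(- (rot * z)) powr (w - 1) = exp ((w - 1) * (Ln z - 3 * \<i> * of_real pi / 4))"
      using z0 by (simp add: powr_def)
    also have "\<dots> = exp (- ((w - 1) * (3 * \<i> * of_real pi / 4)) + (w - 1) * Ln z)"
      by (rule arg_cong[of _ _ exp]) (simp add: algebra_simps)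
    also have "\<dots> = exp (- ((w - 1) * (3 * \<i> * of_real pi / 4))) * z powr (w - 1)"
      using z0 unfolding exp_add by (simp add: powr_def)
    finally have pw: "(- (rot * z)) powr (w - 1) = exp (- ((w - 1) * (3 * \<i> * of_real pi / 4))) * z powr (w - 1)" .
    have "exp (- ((w - 1) * (3 * \<i> * of_real pi / 4))) * rot = exp (\<i> * of_real pi * w / 4 + - (\<i> * of_real pi * w) + \<i> * of_real pi)"
      unfolding rot_eq_exp exp_add[symmetric] by (rule arg_cong[of _ _ exp]) (simp add: field_simps)
    also have "\<dots> = - (\<alpha> * \<epsilon>)"
      unfolding exp_add \<alpha>_def \<epsilon>_def by simp
    finally have e: "exp (- ((w - 1) * (3 * \<i> * of_real pi / 4))) * rot = - (\<alpha> * \<epsilon>)" .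
    have sq': "(- (rot * z))\<^sup>2 = \<i> * z\<^sup>2" by (simp add: power_mult_distrib rot_sq)
    define D where "D = exp (of_real pi * \<i> * (rot * z)) - exp (- (of_real pi * \<i> * (rot * z)))"
    have "F (- t) = (- (rot * z)) powr (w - 1) * exp (of_real pi * \<i> * (\<i> * z\<^sup>2)) / (- D) * rot"
      unfolding F_def Let_def x sq' D_def by simp
    also have "of_real pi * \<i> * (\<i> * z\<^sup>2) = - of_real pi * z\<^sup>2"
      by (simp add: mult.assoc)
    also have "(- (rot * z)) powr (w - 1) * exp (- of_real pi * z\<^sup>2) / (- D) * rot =
        exp (- ((w - 1) * (3 * \<i> * of_real pi / 4))) * rot * (z powr (w - 1) * exp (- of_real pi * z\<^sup>2) / (- D))"
      unfolding pw by (simp only: divide_inverse mult_ac)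
    also have "\<dots> = - (\<alpha> * \<epsilon>) * raux.G w z"
      unfolding e raux_G_eq[OF z0] D_def[symmetric] by simp
    finally show ?thesis by (simp add: z_def)
  qed
  define F1 where "F1 t = indicator {0..} t *\<^sub>R raux.G w (a + of_real t)" for t :: real
  define F2 where "F2 t = indicator {0..} t *\<^sub>R raux.G w (- a + of_real t)" for t :: real
  have F1: "integrable lborel F1" "(LINT t|lborel. F1 t) = L - H a"
    using raux.set_integrable_G[OF w a(1)] bspec[OF L a(1)]
    unfolding F1_def set_integrable_def set_lebesgue_integral_def by auto
  have F2: "integrable lborel F2" "(LINT t|lborel. F2 t) = L - H (- a)"
    using raux.set_integrable_G[OF w a(2)] bspec[OF L a(2)]
    unfolding F2_def set_integrable_def set_lebesgue_integral_def by auto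
  have F2m: "integrable lborel (\<lambda>t. F2 (0 + (-1) * t))" "(LINT t|lborel. F2 (0 + (-1) * t)) = L - H (- a)"
    using F2 lborel_integrable_real_affine[OF F2(1), of "-1" 0] lborel_integral_real_affine[of "-1" F2 0] by auto
  \<comment> \<open>The reflected half line loses the point 0, which \<open>F1\<close> already
    counts; this changes only a null set.\<close>
  define F3 where "F3 t = indicator {..<0} t *\<^sub>R F2 (0 + (-1) * t)" for t :: real
  have F3: "integrable lborel F3"
    unfolding F3_def by (intro integrable_mult_indicator F2m) auto
  have "AE t in lborel. F3 t = F2 (0 + (-1) * t)"
    using AE_lborel_singleton[of "0::real"] by eventually_elim (auto simp: F3_def F2_def indicator_def)
  then have F3_eq: "(LINT t|lborel. F3 t) = L - H (- a)"
    unfolding F2m(2)[symmetric] using F3 F2m(1) by (intro integral_cong_AE) auto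
  have "F t = - \<alpha> * F1 t + - (\<alpha> * \<epsilon>) * F3 t" for t
    using F_pos[of t] F_neg[of "- t"] by (cases "t \<ge> 0") (auto simp: F1_def F2_def F3_def)
  then have "(LINT t|lborel. F t) = (LINT t|lborel. - \<alpha> * F1 t + - (\<alpha> * \<epsilon>) * F3 t)"
    by simp
  also have "\<dots> = - \<alpha> * (L - H a) + - (\<alpha> * \<epsilon>) * (L - H (- a))"
    using F1 F3 F3_eq by simp
  finally have "Riemann_aux c (1 - w) = \<alpha> * (L - H a) + \<alpha> * \<epsilon> * (L - H (- a))"
    unfolding Riemann_aux_def F_def by simp
  also have "\<dots> = \<alpha> * (L + \<epsilon> * L - (H a + \<epsilon> * H (- a)))"
    by (simp add: algebra_simps)
  also have "\<dots> = \<alpha> * (1 + \<epsilon>) * (L - H 0)"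
    unfolding sym by (simp add: algebra_simps)
  finally show ?thesis
    unfolding J \<alpha>_def \<epsilon>_def .
qed

section \<open>The quotient on the domain\<close>

text \<open>For n >= 2 the term n^(-Re w) is at most 2^(2 - Re w) n^(-2), so zeta w - 1 is at most
  2^(2 - Re w) (\<pi>^2/6 - 1). No bound on Im w enters.\<close>

lemma zeta_inverse_asymp:
  assumes r: "2 \<le> r" and w: "6 * ln r \<le> Re w" "2 < Re w"
  shows "cmod (1 / zeta w - 1) \<le> 2 / r"
proof -
  define f where "f n = of_nat (Suc n) powr (- w)" for n
  define g where "g n = 2 powr (2 - Re w) * (1 / (real n + 1)\<^sup>2)" for n
  have g_sums: "g sums (2 powr (2 - Re w) * (pi\<^sup>2 / 6))"
    unfolding g_def using inverse_squares_sums by (intro sums_mult) (simp add: add.commute)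
  have norm_f: "cmod (f n) = real (Suc n) powr (- Re w)" for n
    unfolding f_def by (simp add: norm_powr_real_powr)
  have f_le: "cmod (f (Suc n)) \<le> g (Suc n)" for n
  proof -
    have "real (Suc (Suc n)) powr (- Re w) = real (Suc (Suc n)) powr (2 - Re w) * real (Suc (Suc n)) powr (- 2)"
      by (simp flip: powr_add)
    also have "\<dots> \<le> 2 powr (2 - Re w) * real (Suc (Suc n)) powr (- 2)"
      using w by (intro mult_right_mono powr_mono2') auto
    also have "real (Suc (Suc n)) powr (- 2) = 1 / (real (Suc n) + 1)\<^sup>2"
      by (simp add: powr_minus divide_inverse add_ac flip: powr_numeral)
    finally show ?thesis by (simp only: norm_f g_def)
  qed
  have g_Suc: "summable (\<lambda>n. g (Suc n))"
    using sums_summable[OF g_sums] by (simp only: summable_Suc_iff)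
  have f_Suc: "summable (\<lambda>n. cmod (f (Suc n)))"
    by (rule summable_comparison_test'[OF g_Suc, of 0]) (use f_le in auto)
  then have f_sum: "summable f"
    using summable_norm_cancel summable_Suc_iff by blast
  have "zeta w = (\<Sum>n. f n)" using w by (simp add: zeta_def f_def)
  moreover have "f 0 = 1" by (simp add: f_def)
  ultimately have "zeta w - 1 = (\<Sum>n. f (Suc n))"
    using suminf_split_head[OF f_sum] by simp
  also have "cmod \<dots> \<le> (\<Sum>n. cmod (f (Suc n)))"
    by (rule summable_norm[OF f_Suc])
  also have "\<dots> \<le> (\<Sum>n. g (Suc n))"
    by (intro suminf_le f_le f_Suc g_Suc)
  also have "\<dots> = 2 powr (2 - Re w) * (pi\<^sup>2 / 6) - g 0"
    using suminf_split_head[OF sums_summable[OF g_sums]] sums_unique[OF g_sums] by simp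
  also have "\<dots> = 2 powr (2 - Re w) * (pi\<^sup>2 / 6 - 1)"
    by (simp add: g_def algebra_simps)
  also have "\<dots> \<le> (4 / r ^ 4) * 2"
  proof (rule mult_mono)
    \<comment> \<open>With ln 2 >= 2/3 the hypothesis gives 2^(-Re w) <= r^(-4), and r^3 >= 8 then
      absorbs the numerical factors.\<close>
    have "ln 2 * (6 * ln r) \<le> ln 2 * Re w" using w by (intro mult_left_mono) auto
    moreover have "2 / 3 * (6 * ln r) \<le> ln 2 * (6 * ln r)"
      using ln2_ge_two_thirds r by (intro mult_right_mono) auto
    ultimately have "4 * ln r \<le> ln 2 * Re w" by linarith
    then have "- (Re w * ln 2) \<le> - (4 * ln r)" by (simp only: mult.commute neg_le_iff_le)
    then have "exp (- (Re w * ln 2)) \<le> exp (- (4 * ln r))" by simp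
    also have "exp (- (4 * ln r)) = 1 / r ^ 4"
    proof -
      have "exp (4 * ln r) = r ^ 4"
        using r exp_of_nat_mult[of 4 "ln r"] by simp
      then show ?thesis by (simp add: exp_minus divide_inverse)
    qed
    finally have "2 powr (- Re w) \<le> 1 / r ^ 4" by (simp add: powr_def)
    then show "2 powr (2 - Re w) \<le> 4 / r ^ 4"
      by (simp add: powr_diff powr_minus divide_inverse)
    have "pi\<^sup>2 \<le> 4\<^sup>2" using pi_less_4 by (intro power_mono) auto
    then show "pi\<^sup>2 / 6 - 1 \<le> 2" by simp
    have "3\<^sup>2 \<le> pi\<^sup>2" using pi_gt3 by (intro power_mono) auto
    then show "0 \<le> pi\<^sup>2 / 6 - 1" by simp
  qed (use r in auto)
  also have "\<dots> \<le> 1 / r"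
  proof -
    have "2 ^ 3 \<le> r ^ 3" using r by (intro power_mono) auto
    moreover have "r ^ 4 = r * r ^ 3" by (simp add: power_Suc[symmetric] del: power_Suc)
    ultimately show ?thesis using r by (simp add: divide_simps)
  qed
  finally have d: "cmod (zeta w - 1) \<le> 1 / r" .
  also have "1 / r \<le> 1 / 2" using r by (simp add: divide_simps)
  finally have "cmod (zeta w - 1) \<le> 1 / 2" .
  then have z: "cmod (zeta w) \<ge> 1 / 2"
    using norm_triangle_ineq2[of 1 "1 - zeta w"] by (simp add: norm_minus_commute)
  then have z0: "zeta w \<noteq> 0" by auto
  have "1 / zeta w - 1 = (1 - zeta w) / zeta w" using z0 by (simp add: divide_simps)
  then have "cmod (1 / zeta w - 1) = cmod (zeta w - 1) / cmod (zeta w)"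
    by (simp add: norm_divide norm_minus_commute)
  also have "\<dots> \<le> (1 / r) / (1 / 2)"
    using d z r by (intro frac_le) auto
  finally show "cmod (1 / zeta w - 1) \<le> 2 / r" by simp
qed

text \<open>With y = x/2 the double angle formula and sin y >= y cos y give sin x >= 2 y cos^2 y,
  and cos^2 y >= 1/2 for y <= \<pi>/4.\<close>

lemma half_le_sin:
  fixes x :: real
  assumes "0 \<le> x" "x \<le> pi / 2"
  shows "x / 2 \<le> sin x"
proof -
  define y where "y = x / 2"
  have y: "0 \<le> y" "y \<le> pi / 4" using assms by (auto simp: y_def)
  have "sin 0 - 0 * cos 0 \<le> sin y - y * cos y"
  proof (rule DERIV_nonneg_imp_nondecreasing[OF y(1), of "\<lambda>y. sin y - y * cos y"])
    fix t assume t: "0 \<le> t" "t \<le> y"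
    have "((\<lambda>y. sin y - y * cos y) has_real_derivative t * sin t) (at t)"
      by (auto intro!: derivative_eq_intros)
    moreover have "0 \<le> t * sin t" using t y by (intro mult_nonneg_nonneg sin_ge_zero) auto
    ultimately show "\<exists>d. ((\<lambda>y. sin y - y * cos y) has_real_derivative d) (at t) \<and> 0 \<le> d" by blast
  qed
  then have s: "y * cos y \<le> sin y" by simp
  have "cos (pi / 4) \<le> cos y" using y by (intro cos_monotone_0_pi_le) auto
  then have c: "sqrt 2 / 2 \<le> cos y" by (simp add: cos_45)
  then have "(sqrt 2 / 2)\<^sup>2 \<le> (cos y)\<^sup>2" by (intro power_mono) auto
  then have "1 / 2 \<le> (cos y)\<^sup>2" by (simp add: power_divide)
  then have "2 * y * (1 / 2) \<le> 2 * y * (cos y)\<^sup>2" using y by (intro mult_left_mono) auto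
  also have "\<dots> = 2 * (y * cos y) * cos y" by (simp add: power2_eq_square)
  also have "\<dots> \<le> 2 * sin y * cos y"
  proof (intro mult_right_mono mult_left_mono s)
    show "0 \<le> cos y" using c real_sqrt_ge_zero[of 2] by linarith
  qed auto
  also have "\<dots> = sin x" by (simp add: y_def sin_double[symmetric])
  finally show ?thesis by (simp add: y_def)
qed

text \<open>The curved edge of \<Omega> enters only here: x = \<pi> - 2\<phi> exceeds 2 ln r / r^2,
  so Re w = 2\<pi> r^2 sin x >= 2\<pi> ln r >= 6 ln r. The condition r > e makes ln r >= 1, which
  gives Re w > 2.\<close>

lemma Omega_rot:
  assumes "\<eta> \<in> Omega"
  obtains \<omega> where "\<eta> = rot * \<omega>" "0 < Im \<omega>" "Im \<omega> < Re \<omega>" "cmod \<omega> = cmod \<eta>" "2 \<le> cmod \<omega>"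
    "6 * ln (cmod \<omega>) \<le> Re (2 * of_real pi * \<omega>\<^sup>2)" "2 < Re (2 * of_real pi * \<omega>\<^sup>2)"
proof -
  obtain r \<phi> where \<eta>: "\<eta> = of_real r * cis \<phi>" and r: "exp 1 < r"
    and \<phi>: "pi / 4 < \<phi>" "\<phi> < pi / 2 - ln r / r\<^sup>2"
    using assms by (auto simp: Omega_def)
  define \<theta> where "\<theta> = \<phi> - pi / 4"
  define \<omega> where "\<omega> = of_real r * cis \<theta>"
  have r2: "2 \<le> r" using r exp_ge_add_one_self[of 1] by linarith
  have ln_r: "1 \<le> ln r" using r r2 by (metis less_eq_real_def ln_exp ln_le_cancel_iff exp_gt_zero order_less_trans)
  have "ln r / r\<^sup>2 > 0" using ln_r r2 by (intro divide_pos_pos) auto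
  then have \<theta>: "0 < \<theta>" "\<theta> < pi / 4" using \<phi> by (auto simp: \<theta>_def)
  have 1: "\<eta> = rot * \<omega>" by (simp add: \<eta> \<omega>_def \<theta>_def cis_mult mult.left_commute)
  have "0 < sin \<theta>" using \<theta> by (intro sin_gt_zero) auto
  then have 2: "0 < Im \<omega>" using r2 by (simp add: \<omega>_def)
  have "sin \<theta> < sin (pi / 4)" using \<theta> by (intro sin_monotone_2pi) auto
  also have "\<dots> = cos (pi / 4)" by (simp add: sin_45 cos_45)
  also have "\<dots> < cos \<theta>" using \<theta> by (intro cos_monotone_0_pi) auto
  finally have 3: "Im \<omega> < Re \<omega>" using r2 by (simp add: \<omega>_def)
  have n: "cmod \<omega> = r" "cmod \<eta> = r" using r2 by (auto simp: \<omega>_def \<eta> norm_mult)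
  define x where "x = pi / 2 - 2 * \<theta>"
  have x: "2 * ln r / r\<^sup>2 \<le> x" 
  proof -
    define q where "q = ln r / r\<^sup>2"
    have "x = pi - 2 * \<phi>" by (simp add: x_def \<theta>_def)
    moreover have "\<phi> < pi / 2 - q" using \<phi>(2) by (simp add: q_def)
    ultimately have "2 * q \<le> x" by simp
    then show ?thesis by (simp add: q_def)
  qed
  have "Re (\<omega>\<^sup>2) = r\<^sup>2 * cos (2 * \<theta>)"
    by (simp add: \<omega>_def power_mult_distrib Complex.DeMoivre)
  also have "cos (2 * \<theta>) = sin x" by (simp add: x_def sin_cos_eq)
  finally have "Re (2 * of_real pi * \<omega>\<^sup>2) = 2 * pi * (r\<^sup>2 * sin x)" by simp
  moreover have "2 * pi * ln r \<le> 2 * pi * (r\<^sup>2 * sin x)"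
  proof (intro mult_left_mono)
    have "ln r = r\<^sup>2 * ((2 * ln r / r\<^sup>2) / 2)" using r2 by simp
    also have "\<dots> \<le> r\<^sup>2 * (x / 2)" using x by (intro mult_left_mono divide_right_mono) auto
    also have "\<dots> \<le> r\<^sup>2 * sin x" using \<theta> by (intro mult_left_mono half_le_sin) (auto simp: x_def)
    finally show "ln r \<le> r\<^sup>2 * sin x" .
  qed auto
  moreover have "6 * ln r \<le> 2 * pi * ln r" using pi_gt3 ln_r by (intro mult_right_mono) auto
  ultimately have 4: "6 * ln r \<le> Re (2 * of_real pi * \<omega>\<^sup>2)" by linarith
  show ?thesis
    by (rule that[of \<omega>]) (use 1 2 3 4 n r2 ln_r in auto)
qed

section \<open>Exact formulas for f, g and their quotient\<close>

lemma chi_eq_rGamma: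
  assumes "Im w \<noteq> 0"
  shows "chi w * (2 * cos (of_real pi * w / 2)) = 2 powr w * of_real pi powr w * rGamma w"
proof -
  define u where "u = of_real pi * w / 2"
  have w_nz: "w \<notin> \<int>" using assms by (auto elim: Ints_cases)
  have "Gamma w \<noteq> 0"
    using w_nz by (subst Gamma_eq_zero_iff) (auto dest: nonpos_Ints_Int)
  \<comment> \<open>The claim is the reflection formula combined with sin \<pi>w = 2 sin(\<pi>w/2)
    cos(\<pi>w/2). Im w \<noteq> 0 keeps w off the zeros and poles involved.\<close>
  moreover have refl: "Gamma w * Gamma (1 - w) = of_real pi / sin (of_real pi * w)"
    by (rule Gamma_reflection_complex)
  moreover have sin_nz: "sin (of_real pi * w) \<noteq> 0"
  proof
    assume "sin (of_real pi * w) = 0"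
    then obtain n :: int where "of_real pi * w = of_real (n * pi)"
      using sin_eq_0 by blast
    then have "w = of_int n" by (simp add: mult.commute)
    then show False using w_nz by simp
  qed
  moreover have "sin (of_real pi * w) = 2 * sin u * cos u"
    by (simp add: u_def sin_double[symmetric])
  ultimately have "Gamma (1 - w) * (2 * sin u * cos u) = of_real pi * rGamma w"
    by (simp add: rGamma_inverse_Gamma field_simps)
  moreover have "of_real pi powr (w - 1) * of_real pi = of_real pi powr w"
    by (simp add: powr_diff)
  moreover have "chi w * (2 * cos u) = 2 powr w * of_real pi powr (w - 1) * (Gamma (1 - w) * (2 * sin u * cos u))"
    by (simp add: chi_def u_def)
  ultimately show ?thesis
    by (simp add: u_def mult_ac)
qed

lemma f_Omega_eq:
  assumes \<omega>: "0 < Im \<omega>" "Im \<omega> < Re \<omega>" and c: "0 < c" "c < 1"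
  defines "w \<equiv> 2 * of_real pi * \<omega>\<^sup>2"
  assumes w: "2 < Re w"
  shows "f_Omega c (rot * \<omega>) =
    2 powr w * of_real pi powr w * rGamma w * exp (- (\<i> * of_real pi * w / 4)) * raux.J w / zeta w"
proof -
  have "(rot * \<omega>)\<^sup>2 = \<i> * \<omega>\<^sup>2" by (simp add: power_mult_distrib rot_sq)
  then have s: "2 * of_real pi * \<i> * (rot * \<omega>)\<^sup>2 = - w"
    by (simp only: w_def mult.assoc complex_i_mult_minus mult_minus_right)
  have "Im w = 2 * pi * (2 * Re \<omega> * Im \<omega>)" by (simp add: w_def power2_eq_square)
  also have "\<dots> > 0" using \<omega> by (intro mult_pos_pos) auto
  finally have im: "Im w \<noteq> 0" by simp
  define u where "u = of_real pi * w / 2"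
  have "1 + exp (- (\<i> * of_real pi * w)) = exp (- (\<i> * u)) * (exp (\<i> * u) + exp (- (\<i> * u)))"
    unfolding ring_distribs exp_add[symmetric] by (simp add: u_def mult_ac)
  also have "\<dots> = exp (- (\<i> * u)) * (2 * cos u)"
    by (simp add: cos_exp_eq)
  finally have cos: "1 + exp (- (\<i> * of_real pi * w)) = exp (- (\<i> * u)) * (2 * cos u)" .
  have e: "exp (\<i> * of_real pi * w / 4) * exp (- (\<i> * u)) = exp (- (\<i> * of_real pi * w / 4))"
    unfolding exp_add[symmetric] u_def by (rule arg_cong[of _ _ exp]) (simp add: field_simps)
  have "chi w * Riemann_aux c (1 - w) =
      (chi w * (2 * cos u)) * (exp (\<i> * of_real pi * w / 4) * exp (- (\<i> * u))) * raux.J w"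
    unfolding Riemann_aux_eq_J[OF c w] cos by (simp only: mult_ac)
  also have "\<dots> = 2 powr w * of_real pi powr w * rGamma w * exp (- (\<i> * of_real pi * w / 4)) * raux.J w"
    unfolding e unfolding u_def chi_eq_rGamma[OF im] ..
  finally show ?thesis
    unfolding f_Omega_def s by simp
qed

text \<open>Here \<pi>i\<eta>^2 = -w/2 and log \<eta> = log \<omega> + \<pi>i/4. The constants of u
  are rewritten as b^2/(8\<pi>) and 1/sqrt 2, the form in which the Gaussian integral delivers
  them.\<close>

lemma g_Omega_rot:
  assumes \<omega>: "0 < Im \<omega>" "Im \<omega> < Re \<omega>"
  defines "w \<equiv> 2 * of_real pi * \<omega>\<^sup>2"
  shows "g_Omega (rot * \<omega>) =
    exp (- (w * Ln \<omega>) - \<i> * of_real pi * w / 4 + w / 2 + of_real pi * \<i> * rot * \<omega>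
      + (of_real pi * \<i> * rot)\<^sup>2 / (8 * of_real pi)) / of_real (sqrt 2)"
proof -
  have \<omega>0: "\<omega> \<noteq> 0" "0 < Re \<omega>" using \<omega> by auto
  have "Ln (rot * \<omega>) = Ln rot + Ln \<omega>"
  proof (intro Ln_times_simple)
    show "- pi < Im (Ln rot) + Im (Ln \<omega>)" "Im (Ln rot) + Im (Ln \<omega>) \<le> pi"
      using Re_Ln_pos_lt[OF \<omega>0(1)] \<omega>0(2) by (auto simp: rot_eq_exp Ln_exp abs_if split: if_splits)
  qed (use \<omega>0 in auto)
  then have Ln: "Ln (rot * \<omega>) = \<i> * of_real pi / 4 + Ln \<omega>"
    by (simp add: rot_eq_exp Ln_exp)
  have sq: "of_real pi * \<i> * (rot * \<omega>)\<^sup>2 = - (w / 2)"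
    by (simp add: power_mult_distrib rot_sq w_def mult.assoc)
  have b: "(of_real pi * \<i> * rot)\<^sup>2 / (8 * of_real pi) = - (\<i> * of_real pi / 8)"
  proof -
    have "(of_real pi * \<i> * rot)\<^sup>2 = - (\<i> * (of_real pi)\<^sup>2)"
      by (simp add: power_mult_distrib rot_sq)
    then show ?thesis by (simp add: power2_eq_square)
  qed
  have "of_real pi * \<i> * u_Omega (rot * \<omega>) =
      2 * (of_real pi * \<i> * (rot * \<omega>)\<^sup>2) * Ln (rot * \<omega>) - of_real pi * \<i> * (rot * \<omega>)\<^sup>2
      + of_real pi * \<i> * rot * \<omega> - of_real (ln 2 / 2) - \<i> * of_real pi / 8"
    by (simp add: u_Omega_def field_simps)
  also have "\<dots> = (- (w * Ln \<omega>) - \<i> * of_real pi * w / 4 + w / 2 + of_real pi * \<i> * rot * \<omega>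
      + (of_real pi * \<i> * rot)\<^sup>2 / (8 * of_real pi)) - of_real (ln 2 / 2)"
    unfolding sq Ln b by (simp add: field_simps)
  finally have "g_Omega (rot * \<omega>) = exp (- (w * Ln \<omega>) - \<i> * of_real pi * w / 4 + w / 2 + of_real pi * \<i> * rot * \<omega>
      + (of_real pi * \<i> * rot)\<^sup>2 / (8 * of_real pi)) / exp (of_real (ln 2 / 2))"
    unfolding g_Omega_def by (simp only: exp_diff)
  also have "exp (of_real (ln 2 / 2)) = (of_real (sqrt 2) :: complex)"
  proof -
    have "exp (ln 2 / 2 :: real) = sqrt 2" by (simp add: ln_sqrt[symmetric])
    then show ?thesis by (simp only: exp_of_real)
  qed
  finally show ?thesis .
qed

lemma Stirling_main_eq:
  assumes \<omega>: "0 < Im \<omega>" "Im \<omega> < Re \<omega>"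
  defines "w \<equiv> 2 * of_real pi * \<omega>\<^sup>2"
  shows "Stirling_main \<omega> = 2 powr w * of_real pi powr w * exp (2 * (w * Ln \<omega>) - w) / \<omega>"
proof -
  have \<omega>0: "\<omega> \<noteq> 0" using \<omega> by auto
  have s2: "(of_real (sqrt 2))\<^sup>2 = (2 :: complex)"
    by (metis of_real_power of_real_numeral real_sqrt_pow2 zero_le_numeral)
  have sq: "of_real pi * (of_real (sqrt 2) * \<omega>)\<^sup>2 = w"
    by (simp add: power_mult_distrib s2 w_def)
  have "Ln (of_real (sqrt 2) * \<omega>) = of_real (ln 2 / 2) + Ln \<omega>"
    using \<omega>0 by (simp add: Ln_times_of_real Ln_of_real ln_sqrt)
  then have "(of_real (sqrt 2) * \<omega>) powr (2 * w) = exp (2 * w * (of_real (ln 2 / 2) + Ln \<omega>))"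
    using \<omega>0 by (simp add: powr_def)
  also have "2 * w * (of_real (ln 2 / 2) + Ln \<omega>) = w * of_real (ln 2) + 2 * (w * Ln \<omega>)"
    by (simp add: field_simps)
  also have "exp \<dots> = 2 powr w * exp (2 * (w * Ln \<omega>))"
    unfolding exp_add by (simp add: powr_def flip: Ln_of_real)
  finally have p: "(of_real (sqrt 2) * \<omega>) powr (2 * w) = 2 powr w * exp (2 * (w * Ln \<omega>))" .
  have "gam.saddle_main (of_real (sqrt 2) * \<omega>) = 2 powr w * exp (2 * (w * Ln \<omega>)) / (of_real (sqrt 2) * \<omega>) * exp (- w)"
    unfolding gam.saddle_main_def mult.assoc sq[unfolded mult.assoc] using p sq by simp
  then have "Stirling_main \<omega> = of_real pi powr w * (2 powr w * exp (2 * (w * Ln \<omega>)) * exp (- w) / \<omega>) * (2 / (of_real (sqrt 2))\<^sup>2)"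
    unfolding Stirling_main_def w_def[symmetric] power2_eq_square[of "of_real (sqrt 2)"] by (simp add: mult_ac)
  then show ?thesis
    unfolding s2 by (simp add: exp_diff exp_minus divide_inverse mult_ac)
qed

text \<open>An exact identity: all elementary factors of f and g cancel, and each remaining factor
  is close to 1 by one of the three estimates.\<close>

lemma f_over_g_eq:
  assumes \<omega>: "0 < Im \<omega>" "Im \<omega> < Re \<omega>" and c: "0 < c" "c < 1"
  defines "w \<equiv> 2 * of_real pi * \<omega>\<^sup>2"
  assumes w: "2 < Re w"
  shows "f_Omega c (rot * \<omega>) / g_Omega (rot * \<omega>) =
    (Stirling_main \<omega> * rGamma w) *
    (raux.J w / (raux.saddle_main \<omega> * (exp ((of_real pi * \<i> * rot)\<^sup>2 / (8 * of_real pi)) / of_real (sqrt 2)))) *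
    (1 / zeta w)"
proof -
  define A where "A = 2 powr w * of_real pi powr w"
  define b where "b = of_real pi * \<i> * rot * \<omega>"
  define d where "d = (of_real pi * \<i> * rot)\<^sup>2 / (8 * of_real pi)"
  have \<omega>0: "\<omega> \<noteq> 0" using \<omega> by auto
  have pi2: "- of_real pi * \<omega>\<^sup>2 = - (w / 2)" by (simp add: w_def)
  have main: "raux.saddle_main \<omega> = exp (w * Ln \<omega>) / \<omega> * exp (- (w / 2)) * exp b"
    unfolding raux.saddle_main_def pi2 w_def[symmetric] b_def using \<omega>0 by (simp add: powr_def)
  define g where "g = exp (- (w * Ln \<omega>) - \<i> * of_real pi * w / 4 + w / 2 + b + d)"
  have g: "g_Omega (rot * \<omega>) = g / of_real (sqrt 2)"
    unfolding g_Omega_rot[OF \<omega>] g_def b_def d_def w_def ..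
  have S: "Stirling_main \<omega> = A * exp (2 * (w * Ln \<omega>) - w) / \<omega>"
    unfolding Stirling_main_eq[OF \<omega>] A_def w_def ..
  \<comment> \<open>Up to e^(b^2/(8\<pi>)) and e^(-\<pi>iw/4), g times the exponential part of
    Stirling's main term is the exponential part of the saddle value of \<open>raux.J\<close>. This
    is the whole content of the choice of u.\<close>
  have "exp (2 * (w * Ln \<omega>) - w) * g = exp (w * Ln \<omega> + - (w / 2) + b + d + - (\<i> * of_real pi * w / 4))"
    unfolding g_def exp_add[symmetric] by (rule arg_cong[of _ _ exp]) (simp add: field_simps)
  then have key: "exp (2 * (w * Ln \<omega>) - w) * g = exp (w * Ln \<omega>) * exp (- (w / 2)) * exp b * exp d * exp (- (\<i> * of_real pi * w / 4))"
    unfolding exp_add .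
  have m0: "raux.saddle_main \<omega> \<noteq> 0" using \<omega>0 by (rule raux.saddle_main_nonzero)
  have g0: "g \<noteq> 0" by (simp add: g_def)
  have "Stirling_main \<omega> * g = A * (exp (2 * (w * Ln \<omega>) - w) * g) / \<omega>"
    unfolding S by simp
  also have "\<dots> = A * exp (- (\<i> * of_real pi * w / 4)) * (raux.saddle_main \<omega> * exp d)"
    unfolding key main by simp
  finally have key2: "A * exp (- (\<i> * of_real pi * w / 4)) = Stirling_main \<omega> * g / (raux.saddle_main \<omega> * exp d)"
    using m0 by (simp add: nonzero_eq_divide_eq)
  have "f_Omega c (rot * \<omega>) = (A * exp (- (\<i> * of_real pi * w / 4))) * rGamma w * raux.J w / zeta w"
    unfolding f_Omega_eq[OF \<omega> c w[unfolded w_def]] A_def w_def by (simp only: mult_ac)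
  then show ?thesis
    unfolding key2 g d_def[symmetric] using m0 g0 by (simp add: mult_ac)
qed

lemma norm_mult_minus_1_le:
  fixes x y :: complex
  assumes "1 \<le> r" "cmod (x - 1) \<le> a / r" "cmod (y - 1) \<le> b / r" "0 \<le> a" "0 \<le> b"
  shows "cmod (x * y - 1) \<le> (a + b + a * b) / r"
proof -
  have "x * y - 1 = (x - 1) + (y - 1) + (x - 1) * (y - 1)"
    by (simp add: algebra_simps)
  also have "cmod \<dots> \<le> cmod (x - 1) + cmod (y - 1) + cmod (x - 1) * cmod (y - 1)"
    by (metis norm_mult norm_triangle_le norm_triangle_ineq add_right_mono)
  also have "cmod (x - 1) * cmod (y - 1) \<le> (a / r) * (b / 1)"
  proof (rule mult_mono)
    have "b / r \<le> b / 1" using assms by (intro divide_left_mono) auto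
    then show "cmod (y - 1) \<le> b / 1" using assms by linarith
  qed (use assms in auto)
  finally have "cmod (x * y - 1) \<le> a / r + b / r + a * b / r"
    using assms by simp
  then show ?thesis by (simp add: add_divide_distrib)
qed

theorem proposition8:
  fixes c :: real
  assumes "0 < c" and "c < 1"
  shows "\<exists>K::real. \<forall>\<eta>\<in>Omega. cmod (f_Omega c \<eta> / g_Omega \<eta> - 1) \<le> K / cmod \<eta>"
proof -
  obtain C1 where C1: "C1 \<ge> 0" "\<And>\<omega>. 0 < Im \<omega> \<Longrightarrow> Im \<omega> < Re \<omega> \<Longrightarrow> 1 \<le> cmod \<omega> \<Longrightarrow> 2 < Re (2 * of_real pi * \<omega>\<^sup>2) \<Longrightarrow>
     cmod (Stirling_main \<omega> * rGamma (2 * of_real pi * \<omega>\<^sup>2) - 1) \<le> C1 / cmod \<omega>"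
    using rGamma_asymp by metis
  obtain C2 where C2: "C2 \<ge> 0" "\<And>\<omega>. 0 < Im \<omega> \<Longrightarrow> Im \<omega> < Re \<omega> \<Longrightarrow> 1 \<le> cmod \<omega> \<Longrightarrow> 2 < Re (2 * of_real pi * \<omega>\<^sup>2) \<Longrightarrow>
     cmod (raux.J (2 * of_real pi * \<omega>\<^sup>2) / (raux.saddle_main \<omega> * (exp ((of_real pi * \<i> * rot)\<^sup>2 / (8 * of_real pi)) / of_real (sqrt 2))) - 1) \<le> C2 / cmod \<omega>"
    using raux.J_asymp by metis
  define C where "C = C1 + C2 + C1 * C2"
  have "C \<ge> 0" using C1(1) C2(1) by (simp add: C_def)
  \<comment> \<open>\<open>C\<close> is the error constant of the product of the Gamma and
    \<open>J\<close> quotients, 2 that of 1/zeta; they combine as in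
    \<open>norm_mult_minus_1_le\<close>.\<close>
  have "cmod (f_Omega c \<eta> / g_Omega \<eta> - 1) \<le> (C + 2 + C * 2) / cmod \<eta>" if \<eta>: "\<eta> \<in> Omega" for \<eta>
  proof -
    obtain \<omega> where \<omega>: "\<eta> = rot * \<omega>" "0 < Im \<omega>" "Im \<omega> < Re \<omega>" "cmod \<omega> = cmod \<eta>" "2 \<le> cmod \<omega>"
      "6 * ln (cmod \<omega>) \<le> Re (2 * of_real pi * \<omega>\<^sup>2)" "2 < Re (2 * of_real pi * \<omega>\<^sup>2)"
      using Omega_rot[OF \<eta>] .
    have r: "1 \<le> cmod \<omega>" using \<omega>(5) by linarith
    show ?thesis
      unfolding \<omega>(1) f_over_g_eq[OF \<omega>(2,3) assms \<omega>(7)] \<omega>(4)[symmetric, unfolded \<omega>(1)]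
      using C1(1) C2(1) \<open>C \<ge> 0\<close> r zeta_inverse_asymp[OF \<omega>(5-7)]
      unfolding C_def
      by (intro norm_mult_minus_1_le C1(2)[OF \<omega>(2,3) r \<omega>(7)] C2(2)[OF \<omega>(2,3) r \<omega>(7)]) auto
  qed
  then show ?thesis by blast
qed

end
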